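(* Let $k\ge 0$ be an integer, and let $\mathcal{A}=\{A_1,\ldots,A_n\}$, $\mathcal{B}=\{B_1,\ldots,B_n\}$ be two families of sub-complexes of a finite regular cell complex, such that: (1) $\dim(A_i)\le k$ and $\dim(B_i)\leq k$ for $1\le i\le n$, and (2) $\mathcal{A}\approx_{k+2}\mathcal{B}$. Then $\mathcal{A}$ and $\mathcal{B}$ are homotopy equivalent.
   Context: Notation: $[n]=\{1,\ldots,n\}$; for nonempty $I\subset[n]$, $\mathcal{A}^I=\bigcup_{i\in I}A_i$ and $\mathcal{A}_I=\bigcap_{i\in I}A_i$; $|\cdot|$ is the underlying space. Diagram preserving equivalences. A map $f:|\mathcal{A}^{[n]}|\to|\mathcal{B}^{[n]}|$ is diagram preserving if $f(|\mathcal{A}_I|)\subset|\mathcal{B}_I|$ for every $I\subset[n]$; two such maps are diagram homotopic if they are joined by a homotopy $h(\cdot,t)$, $t\in[0,1]$, that is diagram preserving for each $t$. A diagram preserving map $f$ is a diagram preserving homotopy equivalence if there is a diagram preserving $g:|\mathcal{B}^{[n]}|\to|\mathcal{A}^{[n]}|$ with $g\circ f$ and $f\circ g$ diagram homotopic to the identity maps. $\mathcal{A}$ and $\mathcal{B}$ are homotopy equivalent if there is a diagram preserving homotopy equivalence between them. Homotopy co-limit. Let $\Delta_{[n]}$ be the standard simplex of dimension $n-1$ with vertex set $[n]$, $|\Delta_{[n]}|$ the closed geometric simplex, and $\Delta_I$ the face corresponding to $I$. Then $\mathrm{hocolim}(\mathcal{A})$ is the CW-complex $\coprod_{I\subset[n]}\Delta_I\times\mathcal{A}_I/\!\sim$,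 where for $I\subset J$, $(\mathbf{s},\mathbf{x})\in|\Delta_I|\times|\mathcal{A}_I|$ and $(\mathbf{t},\mathbf{y})\in|\Delta_J|\times|\mathcal{A}_J|$ are identified iff $\mathbf{t}=s_{I,J}(\mathbf{s})$ and $\mathbf{x}=i_{I,J}(\mathbf{y})$, with $s_{I,J}:|\Delta_I|\hookrightarrow|\Delta_J|$ and $i_{I,J}:|\mathcal{A}_J|\hookrightarrow|\mathcal{A}_I|$ the inclusions. Equivalently, $|\mathrm{hocolim}(\mathcal{A})|=\bigcup_{I}|\Delta_I|\times|\mathcal{A}_I|\subset|\Delta_{[n]}|\times|\mathcal{A}^{[n]}|$. Let $f_{\mathcal{A}}:|\mathrm{hocolim}(\mathcal{A})|\to|\mathcal{A}^{[n]}|$, $(\mathbf{s},\mathbf{x})\mapsto\mathbf{x}$, and $g_{\mathcal{A}}:|\mathrm{hocolim}(\mathcal{A})|\to|\Delta_{[n]}|$, $(\mathbf{s},\mathbf{x})\mapsto\mathbf{s}$. For $m\ge0$, $\mathrm{hocolim}_m(\mathcal{A})=g_{\mathcal{A}}^{-1}(\mathrm{sk}_m(\Delta_{[n]}))$, a sub-complex of $\mathrm{hocolim}(\mathcal{A})$, where $\mathrm{sk}_m$ is the $m$-skeleton (so it is all of $\mathrm{hocolim}(\mathcal{A})$ when $m\ge n-1$). Diagram preserving maps, homotopies and homotopy equivalences between $|\mathrm{hocolim}_m(\mathcal{A})|$ and $|\mathrm{hocolim}_m(\mathcal{B})|$ are defined in the same way, replacing $|\mathcal{A}^{[n]}|,|\mathcal{B}^{[n]}|$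 by $|\mathrm{hocolim}_m(\mathcal{A})|,|\mathrm{hocolim}_m(\mathcal{B})|$ and the subspaces $|\mathcal{A}_I|,|\mathcal{B}_I|$ by $f_{\mathcal{A}}^{-1}(|\mathcal{A}_I|)$, $f_{\mathcal{B}}^{-1}(|\mathcal{B}_I|)$ (intersected with the truncated co-limits). We write $\mathcal{A}\approx_m\mathcal{B}$ if there exists a diagram preserving homotopy equivalence $\phi:|\mathrm{hocolim}_m(\mathcal{A})|\to|\mathrm{hocolim}_m(\mathcal{B})|$. The equivalence need not be induced by a map $|\mathcal{A}^{[n]}|\to|\mathcal{B}^{[n]}|$. *)

theory Defs
  imports "HOL-Analysis.Analysis"
begin

definition unit_cell :: "nat \<Rightarrow> (nat \<Rightarrow> real) topology" where
  "unit_cell d = subtopology (Euclidean_space d) {x. (\<Sum>i<d. (x i)\<^sup>2) \<le> 1}"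

definition unit_cell_interior :: "nat \<Rightarrow> (nat \<Rightarrow> real) set" where
  "unit_cell_interior d = {x \<in> topspace (unit_cell d). (\<Sum>i<d. (x i)\<^sup>2) < 1}"

definition unit_cell_boundary :: "nat \<Rightarrow> (nat \<Rightarrow> real) set" where
  "unit_cell_boundary d = {x \<in> topspace (unit_cell d). (\<Sum>i<d. (x i)\<^sup>2) = 1}"

text \<open>A finite regular CW complex with underlying space \<open>X\<close>: \<open>K\<close> is the finite set of its
  \<^emph>\<open>open\<close> cells and \<open>dm e\<close> is the dimension of the cell \<open>e\<close>.  Regularity means that the
  characteristic maps are embeddings of closed balls.  As \<open>K\<close> is finite and \<open>X\<close> is Hausdorff,
  the topology of \<open>X\<close> is automatically the weak topology of the cell decomposition, and
  subcomplexes carry the subspace topology.\<close>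

definition finite_regular_cell_complex ::
    "'a topology \<Rightarrow> 'a set set \<Rightarrow> ('a set \<Rightarrow> nat) \<Rightarrow> bool" where
  "finite_regular_cell_complex X K dm \<longleftrightarrow>
     Hausdorff_space X \<and> finite K \<and> pairwise disjnt K \<and> \<Union>K = topspace X \<and>
     (\<forall>e\<in>K. \<exists>\<phi>. continuous_map (unit_cell (dm e)) X \<phi> \<and>
                embedding_map (unit_cell (dm e)) X \<phi> \<and>
                \<phi> ` unit_cell_interior (dm e) = e \<and>
                \<phi> ` unit_cell_boundary (dm e) \<subseteq> \<Union>{e'\<in>K. dm e' < dm e})"

text \<open>A subcomplex is given by its set \<open>L\<close> of open cells; its underlying space is \<open>\<Union>L\<close>.\<close>

definition subcomplex :: "'a topology \<Rightarrow> 'a set set \<Rightarrow> 'a set set \<Rightarrow> bool" where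
  "subcomplex X K L \<longleftrightarrow> L \<subseteq> K \<and> (\<forall>e\<in>L. X closure_of e \<subseteq> \<Union>L)"

text \<open>The empty complex has dimension \<open>-1\<close>.\<close>

definition complex_dim :: "('a set \<Rightarrow> nat) \<Rightarrow> 'a set set \<Rightarrow> int" where
  "complex_dim dm L = (if L = {} then -1 else int (Max (dm ` L)))"

text \<open>The nonempty subsets of \<open>[n] = {1..n}\<close>.\<close>

definition index_sets :: "nat \<Rightarrow> nat set set" where
  "index_sets n = {I. I \<noteq> {} \<and> I \<subseteq> {1..n}}"

definition union_carrier :: "(nat \<Rightarrow> 'a set set) \<Rightarrow> nat set \<Rightarrow> 'a set" where
  "union_carrier A I = \<Union>(\<Union>i\<in>I. A i)"

definition inter_carrier :: "(nat \<Rightarrow> 'a set set) \<Rightarrow> nat set \<Rightarrow> 'a set" where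
  "inter_carrier A I = \<Union>(\<Inter>i\<in>I. A i)"

definition union_space :: "'a topology \<Rightarrow> (nat \<Rightarrow> 'a set set) \<Rightarrow> nat \<Rightarrow> 'a topology" where
  "union_space X A n = subtopology X (union_carrier A {1..n})"

text \<open>The following notions are used both for the spaces \<open>|A^[n]|\<close> and for the truncated
  homotopy co-limits: \<open>S\<close> and \<open>T\<close> are spaces equipped with distinguished
  subsets \<open>D I\<close> and \<open>E I\<close> indexed by the nonempty sets \<open>I \<subseteq> [n]\<close>.\<close>

definition respects_diagram ::
    "nat \<Rightarrow> (nat set \<Rightarrow> 'a set) \<Rightarrow> (nat set \<Rightarrow> 'b set) \<Rightarrow> ('a \<Rightarrow> 'b) \<Rightarrow> bool" where
  "respects_diagram n D E f \<longleftrightarrow> (\<forall>I\<in>index_sets n. f ` D I \<subseteq> E I)"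

definition diagram_preserving ::
    "nat \<Rightarrow> 'a topology \<Rightarrow> (nat set \<Rightarrow> 'a set) \<Rightarrow> 'b topology \<Rightarrow> (nat set \<Rightarrow> 'b set)
      \<Rightarrow> ('a \<Rightarrow> 'b) \<Rightarrow> bool" where
  "diagram_preserving n S D T E f \<longleftrightarrow> continuous_map S T f \<and> respects_diagram n D E f"

definition diagram_homotopic ::
    "nat \<Rightarrow> 'a topology \<Rightarrow> (nat set \<Rightarrow> 'a set) \<Rightarrow> 'b topology \<Rightarrow> (nat set \<Rightarrow> 'b set)
      \<Rightarrow> ('a \<Rightarrow> 'b) \<Rightarrow> ('a \<Rightarrow> 'b) \<Rightarrow> bool" where
  "diagram_homotopic n S D T E f g \<longleftrightarrow> homotopic_with (respects_diagram n D E) S T f g"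

definition diagram_homotopy_equivalence ::
    "nat \<Rightarrow> 'a topology \<Rightarrow> (nat set \<Rightarrow> 'a set) \<Rightarrow> 'b topology \<Rightarrow> (nat set \<Rightarrow> 'b set)
      \<Rightarrow> ('a \<Rightarrow> 'b) \<Rightarrow> bool" where
  "diagram_homotopy_equivalence n S D T E f \<longleftrightarrow>
     diagram_preserving n S D T E f \<and>
     (\<exists>g. diagram_preserving n T E S D g \<and>
          diagram_homotopic n S D S D (g \<circ> f) id \<and>
          diagram_homotopic n T E T E (f \<circ> g) id)"

definition family_homotopy_equivalent ::
    "'a topology \<Rightarrow> nat \<Rightarrow> (nat \<Rightarrow> 'a set set) \<Rightarrow> (nat \<Rightarrow> 'a set set) \<Rightarrow> bool" where
  "family_homotopy_equivalent X n A B \<longleftrightarrow>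
     (\<exists>f. diagram_homotopy_equivalence n
            (union_space X A n) (inter_carrier A) (union_space X B n) (inter_carrier B) f)"

text \<open>The closed face \<open>\<Delta>_I\<close>, in barycentric coordinates, of the simplex with vertex set \<open>[n]\<close>,
  for \<open>I \<subseteq> [n]\<close>; in particular \<open>\<Delta>_I \<subseteq> \<Delta>_J\<close> whenever \<open>I \<subseteq> J\<close>.\<close>

definition simplex_face :: "nat set \<Rightarrow> (nat \<Rightarrow> real) set" where
  "simplex_face I = {s. (\<forall>i. 0 \<le> s i) \<and> (\<forall>i. i \<notin> I \<longrightarrow> s i = 0) \<and> (\<Sum>i\<in>I. s i) = 1}"

definition simplex_skeleton :: "nat \<Rightarrow> nat \<Rightarrow> (nat \<Rightarrow> real) set" where
  "simplex_skeleton m n = (\<Union>I\<in>{I\<in>index_sets n. card I \<le> m + 1}. simplex_face I)"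

text \<open>The homotopy co-limit as a subset of \<open>|\<Delta>_[n]| \<times> |A^[n]|\<close>, on which the maps \<open>f_A\<close> and
  \<open>g_A\<close> are the projections \<^term>\<open>snd\<close> and \<^term>\<open>fst\<close>.\<close>

definition hocolim_carrier :: "nat \<Rightarrow> (nat \<Rightarrow> 'a set set) \<Rightarrow> ((nat \<Rightarrow> real) \<times> 'a) set" where
  "hocolim_carrier n A = (\<Union>I\<in>index_sets n. simplex_face I \<times> inter_carrier A I)"

definition hocolim_trunc_carrier ::
    "nat \<Rightarrow> nat \<Rightarrow> (nat \<Rightarrow> 'a set set) \<Rightarrow> ((nat \<Rightarrow> real) \<times> 'a) set" where
  "hocolim_trunc_carrier m n A = {p \<in> hocolim_carrier n A. fst p \<in> simplex_skeleton m n}"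

definition hocolim_trunc ::
    "'a topology \<Rightarrow> nat \<Rightarrow> nat \<Rightarrow> (nat \<Rightarrow> 'a set set) \<Rightarrow> ((nat \<Rightarrow> real) \<times> 'a) topology" where
  "hocolim_trunc X m n A =
     subtopology (prod_topology (subtopology (powertop_real UNIV) (simplex_face {1..n}))
                                (union_space X A n))
                 (hocolim_trunc_carrier m n A)"

definition hocolim_trunc_inter ::
    "nat \<Rightarrow> nat \<Rightarrow> (nat \<Rightarrow> 'a set set) \<Rightarrow> nat set \<Rightarrow> ((nat \<Rightarrow> real) \<times> 'a) set" where
  "hocolim_trunc_inter m n A I = {p \<in> hocolim_trunc_carrier m n A. snd p \<in> inter_carrier A I}"

text \<open>The relation \<open>A \<approx>_m B\<close>.\<close>

definition hocolim_equivalent ::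
    "'a topology \<Rightarrow> nat \<Rightarrow> nat \<Rightarrow> (nat \<Rightarrow> 'a set set) \<Rightarrow> (nat \<Rightarrow> 'a set set) \<Rightarrow> bool" where
  "hocolim_equivalent X m n A B \<longleftrightarrow>
     (\<exists>\<phi>. diagram_homotopy_equivalence n
            (hocolim_trunc X m n A) (hocolim_trunc_inter m n A)
            (hocolim_trunc X m n B) (hocolim_trunc_inter m n B) \<phi>)"

end

theory Submission
  imports Defs
begin

text \<open>Write \<open>|A|\<close> for the union of the spaces \<open>|A i|\<close>, and put \<open>m = k + 2\<close>.  A diagram preserving homotopy equivalence
  \<open>\<phi>\<close> of the truncated co-limits, with inverse \<open>\<psi>\<close>, descends to the unions as soon as
  the projections \<open>snd\<close> from the co-limits have homotopy sections.  If \<open>\<sigma>\<close> and \<open>\<sigma>'\<close> are such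
  sections for \<open>A\<close> and \<open>B\<close>, then the maps \<open>snd \<circ> \<phi> \<circ> \<sigma>\<close> and \<open>snd \<circ> \<psi> \<circ> \<sigma>'\<close> are inverse to each other up to
  diagram homotopy.

  A section \<open>\<sigma>\<close> consists of a collapsed point and of barycentric coordinates for it.  It is
  constructed cell by cell (\<open>labelled_collapse_exists\<close>): a homotopy \<open>h\<close> that preserves all subcomplexes
  collapses a collar of each cell onto its boundary.  In the collar the indices used on the
  boundary remain valid for the collapsed points, which leaves room to pass continuously from them
  to an index of the cell itself.  The composite \<open>snd \<circ> \<sigma>\<close> is the end of the homotopy \<open>h\<close>, and thus
  diagram homotopic to the identity.

  For the composite of the two maps it remains to cancel \<open>\<sigma>' \<circ> snd\<close> in \<open>\<sigma>' \<circ> snd \<circ> w\<close>, where \<open>w = \<phi> \<circ> \<sigma>\<close>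
  (\<open>homotopic_collapse_section_snd\<close>).  The two maps into the co-limit have homotopic second
  components, and at each point both families of barycentric coordinates lie in the simplex of the collapsed
  second component; so the straight-line homotopy connects them in the full co-limit of \<open>B\<close>.  It
  is parametrised by the cylinder over \<open>|A|\<close>, whose dimension is at most \<open>k + 1\<close>, and can therefore be pushed into the
  \<open>m\<close>-skeleton without enlarging any support and without changing its ends
  (\<open>push_into_skeleton\<close>).

  Pushing a map off a simplex requires a small perturbation of a tuple of real functions to one without
  common zero.  On spaces of small dimension such perturbations exist
  (\<open>zero_avoidable_subcomplex_cylinder\<close>): by compactness and Tietze's theorem it suffices to consider one closed
  cell at a time, and there the Stone-Weierstrass theorem gives Lipschitz approximations; a pigeonhole
  count provides a small value that they miss, by which they are shifted.\<close>

section \<open>Perturbing functions on low-dimensional spaces\<close>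

text \<open>Pigeonhole replaces measure theory here.  A grid of \<open>M ^ card J\<close> candidate values with mesh
  \<open>\<eta> / M\<close> is compared with the \<open>(2 * N + 1) ^ p\<close> boxes into which the coordinates sort the points of
  \<open>S\<close>.  If \<open>N\<close> is a sufficiently large multiple of \<open>M\<close>, then two points of the same box have values
  closer than the mesh, so each box accounts for at most one grid value; as \<open>p < card J\<close>, for
  large \<open>M\<close> there are more grid values than boxes.\<close>

lemma lipschitz_map_misses_small_value:
  fixes c :: "nat \<Rightarrow> 'b \<Rightarrow> real" and g :: "nat \<Rightarrow> 'b \<Rightarrow> real"
  assumes J: "finite J" "p < card J"
    and bound: "\<And>i x. i < p \<Longrightarrow> x \<in> S \<Longrightarrow> \<bar>c i x\<bar> \<le> 1"
    and Lip: "\<And>j x y. j \<in> J \<Longrightarrow> x \<in> S \<Longrightarrow> y \<in> S \<Longrightarrow>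
                 \<bar>g j x - g j y\<bar> \<le> L * (\<Sum>i<p. \<bar>c i x - c i y\<bar>)"
    and "0 < \<eta>"
  shows "\<exists>v. (\<forall>j\<in>J. 0 \<le> v j \<and> v j < \<eta>) \<and> (\<forall>x\<in>S. \<exists>j\<in>J. g j x \<noteq> v j)"
proof (rule ccontr)
  assume contra: "\<not> ?thesis"
  \<comment> \<open>With \<open>N = Q * M\<close>, this \<open>Q\<close> makes the variation of \<open>g\<close> on a box smaller than the mesh.\<close>
  obtain Q :: nat where Q: "\<bar>L\<bar> * (real p + 1) / \<eta> < real Q"
    using reals_Archimedean2 by blast
  have "0 \<le> \<bar>L\<bar> * (real p + 1) / \<eta>"
    using \<open>0 < \<eta>\<close> by simp
  with Q have "0 < Q"
    by (metis le_less_trans of_nat_0_less_iff)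
  \<comment> \<open>The value of \<open>M\<close> is chosen so that \<open>(3 * Q * M) ^ p < M ^ (p + 1)\<close>.\<close>
  define M where "M = (3 * Q) ^ p + 1"
  define N where "N = Q * M"
  have "0 < M" by (simp add: M_def)
  then have "0 < N" using \<open>0 < Q\<close> by (simp add: N_def)
  define val where "val a j = \<eta> * real (a j) / real M" for a :: "nat \<Rightarrow> nat" and j
  define box where "box x = (\<lambda>i\<in>{..<p}. nat \<lfloor>real N * (c i x + 1)\<rfloor>)" for x
  define G where "G = (PiE J (\<lambda>_. {..<M}))"
  have "\<exists>x\<in>S. \<forall>j\<in>J. g j x = val a j" if "a \<in> G" for a
  proof -
    have "\<forall>j\<in>J. 0 \<le> val a j \<and> val a j < \<eta>"
    proof
      fix j assume "j \<in> J"
      then have "a j < M" using that by (auto simp: G_def)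
      then have "real (a j) / real M < 1" by simp
      then have "\<eta> * (real (a j) / real M) < \<eta> * 1"
        using \<open>0 < \<eta>\<close> by (intro mult_strict_left_mono)
      then show "0 \<le> val a j \<and> val a j < \<eta>"
        using \<open>0 < \<eta>\<close> by (simp add: val_def)
    qed
    then show ?thesis using contra by blast
  qed
  then obtain pt where pt: "\<And>a. a \<in> G \<Longrightarrow> pt a \<in> S" "\<And>a j. a \<in> G \<Longrightarrow> j \<in> J \<Longrightarrow> g j (pt a) = val a j"
    by metis
  have "inj_on (\<lambda>a. box (pt a)) G"
  proof (rule inj_onI, rule ccontr)
    fix a b assume ab: "a \<in> G" "b \<in> G" "box (pt a) = box (pt b)" "a \<noteq> b"
    then obtain j where j: "j \<in> J" "a j \<noteq> b j"
      unfolding G_def by (metis PiE_ext)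
    have near: "\<bar>c i (pt a) - c i (pt b)\<bar> \<le> 1 / real N" if "i < p" for i
    proof -
      have "nat \<lfloor>real N * (c i (pt a) + 1)\<rfloor> = nat \<lfloor>real N * (c i (pt b) + 1)\<rfloor>"
        using fun_cong [OF ab(3), of i] that by (simp add: box_def)
      moreover have "0 \<le> c i (pt a) + 1" "0 \<le> c i (pt b) + 1"
        using bound[OF that pt(1)[OF ab(1)]] bound[OF that pt(1)[OF ab(2)]] by auto
      then have "0 \<le> \<lfloor>real N * (c i (pt a) + 1)\<rfloor>" "0 \<le> \<lfloor>real N * (c i (pt b) + 1)\<rfloor>"
        by simp_all
      ultimately have "\<lfloor>real N * (c i (pt a) + 1)\<rfloor> = \<lfloor>real N * (c i (pt b) + 1)\<rfloor>"
        by linarith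
      then have "\<bar>real N * (c i (pt a) + 1) - real N * (c i (pt b) + 1)\<bar> \<le> 1"
        by linarith
      moreover have "real N * (c i (pt a) + 1) - real N * (c i (pt b) + 1) = real N * (c i (pt a) - c i (pt b))"
        by (simp add: algebra_simps)
      ultimately have "real N * \<bar>c i (pt a) - c i (pt b)\<bar> \<le> 1"
        by (simp add: abs_mult)
      then show ?thesis using \<open>0 < N\<close> by (simp add: field_simps)
    qed
    have "\<eta> / real M \<le> \<bar>val a j - val b j\<bar>"
    proof -
      have "1 \<le> \<bar>real (a j) - real (b j)\<bar>"
        using j(2) by linarith
      then have "\<eta> / real M * 1 \<le> \<eta> / real M * \<bar>real (a j) - real (b j)\<bar>"
        using \<open>0 < \<eta>\<close> by (intro mult_left_mono) auto
      also have "\<dots> = \<bar>\<eta> / real M * (real (a j) - real (b j))\<bar>"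
        using \<open>0 < \<eta>\<close> by (simp add: abs_mult)
      also have "\<dots> = \<bar>val a j - val b j\<bar>"
        by (simp add: val_def right_diff_distrib)
      finally show ?thesis by simp
    qed
    also have "\<dots> = \<bar>g j (pt a) - g j (pt b)\<bar>"
      using pt(2) ab j(1) by simp
    also have "\<dots> \<le> L * (\<Sum>i<p. \<bar>c i (pt a) - c i (pt b)\<bar>)"
      using Lip j(1) pt(1) ab by blast
    also have "\<dots> \<le> \<bar>L\<bar> * (\<Sum>i<p. \<bar>c i (pt a) - c i (pt b)\<bar>)"
      by (intro mult_right_mono) (auto intro: sum_nonneg)
    also have "\<dots> \<le> \<bar>L\<bar> * (\<Sum>i<p. 1 / real N)"
      using near by (intro mult_left_mono sum_mono) auto
    also have "\<dots> = (\<bar>L\<bar> * real p / real Q) / real M"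
      by (simp add: N_def)
    finally have "\<eta> / real M \<le> (\<bar>L\<bar> * real p / real Q) / real M" .
    then have "\<eta> \<le> \<bar>L\<bar> * real p / real Q"
      using \<open>0 < M\<close> by (metis divide_le_cancel not_less of_nat_0_less_iff)
    then have "\<eta> * real Q \<le> \<bar>L\<bar> * real p"
      using \<open>0 < Q\<close> by (simp add: field_simps)
    moreover have "\<bar>L\<bar> * (real p + 1) < \<eta> * real Q"
      using Q \<open>0 < \<eta>\<close> by (simp add: field_simps)
    ultimately show False by (simp add: algebra_simps)
  qed
  moreover have "(\<lambda>a. box (pt a)) ` G \<subseteq> PiE {..<p} (\<lambda>_. {..2 * N})"
  proof (rule image_subsetI)
    fix a assume a: "a \<in> G"
    have "nat \<lfloor>real N * (c i (pt a) + 1)\<rfloor> \<le> 2 * N" if "i < p" for i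
    proof -
      have "real N * (c i (pt a) + 1) \<le> real N * 2"
        using bound[OF that pt(1)[OF a]] by (intro mult_left_mono) auto
      then have "\<lfloor>real N * (c i (pt a) + 1)\<rfloor> \<le> int (2 * N)"
        by linarith
      then show ?thesis by linarith
    qed
    then show "box (pt a) \<in> PiE {..<p} (\<lambda>_. {..2 * N})"
      by (auto simp: box_def)
  qed
  ultimately have "card G \<le> card (PiE {..<p} (\<lambda>_. {..2 * N}))"
    by (rule card_inj_on_le) (auto intro: finite_PiE)
  then have "M ^ card J \<le> (2 * N + 1) ^ p"
    using J(1) by (simp add: G_def card_PiE)
  also have "\<dots> \<le> (3 * Q * M) ^ p"
    using \<open>0 < N\<close> by (intro power_mono) (auto simp: N_def)
  also have "\<dots> = (3 * Q) ^ p * M ^ p"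
    by (simp add: power_mult_distrib)
  also have "\<dots> < M * M ^ p"
    using \<open>0 < M\<close> by (intro mult_strict_right_mono) (auto simp: M_def)
  also have "\<dots> = M ^ Suc p" by simp
  also have "\<dots> \<le> M ^ card J"
    using J(2) \<open>0 < M\<close> by (intro power_increasing) auto
  finally show False by simp
qed

text \<open>The Lipschitz functions form an algebra that separates the points of the compact set \<open>S\<close>, so the
  Stone-Weierstrass theorem applies to it.\<close>

lemma lipschitz_approximation:
  fixes c :: "nat \<Rightarrow> 'b::t2_space \<Rightarrow> real"
  assumes "compact S"
    and cont: "\<And>i. i < p \<Longrightarrow> continuous_on S (c i)"
    and bound: "\<And>i x. i < p \<Longrightarrow> x \<in> S \<Longrightarrow> \<bar>c i x\<bar> \<le> 1"
    and sep: "\<And>x y. x \<in> S \<Longrightarrow> y \<in> S \<Longrightarrow> x \<noteq> y \<Longrightarrow> \<exists>i<p. c i x \<noteq> c i y"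
    and f: "continuous_on S f" and "0 < \<epsilon>"
  shows "\<exists>g L. continuous_on S g \<and> (\<forall>x\<in>S. \<bar>f x - g x\<bar> < \<epsilon>) \<and> 0 \<le> L \<and>
           (\<forall>x\<in>S. \<forall>y\<in>S. \<bar>g x - g y\<bar> \<le> L * (\<Sum>i<p. \<bar>c i x - c i y\<bar>))"
proof -
  define \<delta> where "\<delta> x y = (\<Sum>i<p. \<bar>c i x - c i y\<bar>)" for x y
  have \<delta>0: "0 \<le> \<delta> x y" for x y by (simp add: \<delta>_def sum_nonneg)
  define R where "R = {g. continuous_on S g \<and> (\<exists>L\<ge>0. \<forall>x\<in>S. \<forall>y\<in>S. \<bar>g x - g y\<bar> \<le> L * \<delta> x y)}"
  interpret function_ring_on R S
  proof
    show "compact S" by fact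
  next
    fix f assume "f \<in> R" then show "continuous_on S f" by (simp add: R_def)
  next
    fix f g assume fg: "f \<in> R" "g \<in> R"
    then obtain L1 L2 where L: "0 \<le> L1" "0 \<le> L2"
      "\<And>x y. x\<in>S \<Longrightarrow> y\<in>S \<Longrightarrow> \<bar>f x - f y\<bar> \<le> L1 * \<delta> x y"
      "\<And>x y. x\<in>S \<Longrightarrow> y\<in>S \<Longrightarrow> \<bar>g x - g y\<bar> \<le> L2 * \<delta> x y"
      unfolding R_def by blast
    have "\<bar>f x + g x - (f y + g y)\<bar> \<le> (L1 + L2) * \<delta> x y" if "x \<in> S" "y \<in> S" for x y
      using L(3,4)[OF that] by (simp add: distrib_right)
    with fg L show "(\<lambda>x. f x + g x) \<in> R"
      unfolding R_def by (auto intro!: continuous_intros exI[of _ "L1 + L2"])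
    have "compact (f ` S)" "compact (g ` S)"
      using fg \<open>compact S\<close> by (auto simp: R_def intro: compact_continuous_image)
    then obtain B1 B2 where B: "\<And>x. x \<in> S \<Longrightarrow> \<bar>f x\<bar> \<le> B1" "\<And>x. x \<in> S \<Longrightarrow> \<bar>g x\<bar> \<le> B2"
      by (metis bounded_iff compact_imp_bounded imageI real_norm_def)
    have "\<bar>f x * g x - f y * g y\<bar> \<le> (\<bar>B1\<bar> * L2 + \<bar>B2\<bar> * L1) * \<delta> x y" if xy: "x \<in> S" "y \<in> S" for x y
    proof -
      have "\<bar>f x * g x - f y * g y\<bar> = \<bar>f x * (g x - g y) + g y * (f x - f y)\<bar>"
        by (simp add: algebra_simps)
      also have "\<dots> \<le> \<bar>f x\<bar> * \<bar>g x - g y\<bar> + \<bar>g y\<bar> * \<bar>f x - f y\<bar>"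
        by (metis abs_mult abs_triangle_ineq)
      also have "\<dots> \<le> \<bar>B1\<bar> * (L2 * \<delta> x y) + \<bar>B2\<bar> * (L1 * \<delta> x y)"
        using B[OF xy(1)] B[OF xy(2)] L(3,4)[OF xy] \<delta>0
        by (intro add_mono mult_mono) linarith+
      finally show ?thesis by (simp add: algebra_simps)
    qed
    with fg L show "(\<lambda>x. f x * g x) \<in> R"
      unfolding R_def by (auto intro!: continuous_intros exI[of _ "\<bar>B1\<bar> * L2 + \<bar>B2\<bar> * L1"])
  next
    fix a show "(\<lambda>_. a) \<in> R" by (auto simp: R_def intro!: exI[of _ 0])
  next
    fix x y assume "x \<in> S" "y \<in> S" "x \<noteq> y"
    then obtain i where i: "i < p" "c i x \<noteq> c i y" using sep by blast
    have "\<bar>c i u - c i v\<bar> \<le> 1 * \<delta> u v" for u v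
      unfolding \<delta>_def using i(1) by (simp add: member_le_sum[of i "{..<p}" "\<lambda>i. \<bar>c i u - c i v\<bar>"])
    then have "c i \<in> R" unfolding R_def using cont i(1) by (auto intro!: exI[of _ 1])
    with i show "\<exists>f\<in>R. f x \<noteq> f y" by blast
  qed
  obtain g where "g \<in> R" "\<forall>x\<in>S. \<bar>f x - g x\<bar> < \<epsilon>"
    using Stone_Weierstrass_basic[OF f \<open>0 < \<epsilon>\<close>] by blast
  then show ?thesis unfolding R_def \<delta>_def by blast
qed

text \<open>Every \<open>d\<close>-tuple of continuous functions on \<open>Z\<close> has arbitrarily small perturbations without common
  zero.  For compact metrizable \<open>Z\<close> this is a classical characterisation of covering dimension
  less than \<open>d\<close>; it serves here as the definition of being low-dimensional.\<close>

definition zero_avoidable :: "'z topology \<Rightarrow> nat \<Rightarrow> bool" where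
  "zero_avoidable Z d \<longleftrightarrow>
     (\<forall>(J::nat set) f (\<epsilon>::real). finite J \<longrightarrow> card J = d \<longrightarrow> 0 < \<epsilon> \<longrightarrow>
        (\<forall>j\<in>J. continuous_map Z euclideanreal (f j)) \<longrightarrow>
        (\<exists>g. (\<forall>j\<in>J. continuous_map Z euclideanreal (g j) \<and> (\<forall>z\<in>topspace Z. \<bar>g j z - f j z\<bar> < \<epsilon>)) \<and>
             (\<forall>z\<in>topspace Z. \<exists>j\<in>J. g j z \<noteq> 0)))"

text \<open>A compact set with \<open>p\<close> real coordinates is at most \<open>p\<close>-dimensional: a Lipschitz approximation
  misses some value near zero, and subtracting that value makes it miss zero.\<close>

lemma zero_avoidable_compact_coordinates:
  fixes c :: "nat \<Rightarrow> 'b::t2_space \<Rightarrow> real"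
  assumes "compact S"
    and cont: "\<And>i. i < p \<Longrightarrow> continuous_on S (c i)"
    and bound: "\<And>i x. i < p \<Longrightarrow> x \<in> S \<Longrightarrow> \<bar>c i x\<bar> \<le> 1"
    and sep: "\<And>x y. x \<in> S \<Longrightarrow> y \<in> S \<Longrightarrow> x \<noteq> y \<Longrightarrow> \<exists>i<p. c i x \<noteq> c i y"
    and "p < d"
  shows "zero_avoidable (top_of_set S) d"
  unfolding zero_avoidable_def
proof (intro allI impI)
  fix J :: "nat set" and f :: "nat \<Rightarrow> 'b \<Rightarrow> real" and \<epsilon> :: real
  assume J: "finite J" "card J = d" and "0 < \<epsilon>"
    and f: "\<forall>j\<in>J. continuous_map (top_of_set S) euclideanreal (f j)"
  let ?\<delta> = "\<lambda>x y. \<Sum>i<p. \<bar>c i x - c i y\<bar>"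
  have "\<forall>j\<in>J. \<exists>g L. continuous_on S g \<and> (\<forall>x\<in>S. \<bar>f j x - g x\<bar> < \<epsilon> / 2) \<and> 0 \<le> L \<and>
          (\<forall>x\<in>S. \<forall>y\<in>S. \<bar>g x - g y\<bar> \<le> L * ?\<delta> x y)"
  proof
    fix j assume "j \<in> J"
    then have "continuous_on S (f j)" "0 < \<epsilon> / 2"
      using f \<open>0 < \<epsilon>\<close> by auto
    from lipschitz_approximation[OF assms(1-4) this]
    show "\<exists>g L. continuous_on S g \<and> (\<forall>x\<in>S. \<bar>f j x - g x\<bar> < \<epsilon> / 2) \<and> 0 \<le> L \<and>
          (\<forall>x\<in>S. \<forall>y\<in>S. \<bar>g x - g y\<bar> \<le> L * ?\<delta> x y)" .
  qed
  then obtain g L where gL: "\<forall>j\<in>J. continuous_on S (g j) \<and> (\<forall>x\<in>S. \<bar>f j x - g j x\<bar> < \<epsilon> / 2) \<and> 0 \<le> L j \<and>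
          (\<forall>x\<in>S. \<forall>y\<in>S. \<bar>g j x - g j y\<bar> \<le> L j * ?\<delta> x y)"
    unfolding bchoice_iff by blast
  then have g: "\<And>j. j \<in> J \<Longrightarrow> continuous_on S (g j)"
      "\<And>j x. j \<in> J \<Longrightarrow> x \<in> S \<Longrightarrow> \<bar>f j x - g j x\<bar> < \<epsilon> / 2" and L0: "\<And>j. j \<in> J \<Longrightarrow> 0 \<le> L j"
    by auto
  have "\<bar>g j x - g j y\<bar> \<le> sum L J * ?\<delta> x y" if "j \<in> J" "x \<in> S" "y \<in> S" for j x y
  proof -
    have "L j \<le> sum L J" using J(1) L0 that(1) by (intro member_le_sum) auto
    then have "L j * ?\<delta> x y \<le> sum L J * ?\<delta> x y"
      by (intro mult_right_mono) (auto intro: sum_nonneg)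
    then show ?thesis using gL that by (meson order_trans)
  qed
  then obtain v where v: "\<forall>j\<in>J. 0 \<le> v j \<and> v j < \<epsilon> / 2" "\<forall>x\<in>S. \<exists>j\<in>J. g j x \<noteq> v j"
    using lipschitz_map_misses_small_value[of J p S c g "sum L J" "\<epsilon> / 2"] J \<open>p < d\<close> bound \<open>0 < \<epsilon>\<close> by auto
  show "\<exists>g. (\<forall>j\<in>J. continuous_map (top_of_set S) euclideanreal (g j) \<and>
               (\<forall>z\<in>topspace (top_of_set S). \<bar>g j z - f j z\<bar> < \<epsilon>)) \<and>
             (\<forall>z\<in>topspace (top_of_set S). \<exists>j\<in>J. g j z \<noteq> 0)"
  proof (intro exI[of _ "\<lambda>j x. g j x - v j"] conjI ballI)
    fix j z assume "j \<in> J" "z \<in> topspace (top_of_set S)"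
    then have "\<bar>f j z - g j z\<bar> < \<epsilon> / 2" "0 \<le> v j" "v j < \<epsilon> / 2"
      using g(2) v(1) by auto
    then show "\<bar>g j z - v j - f j z\<bar> < \<epsilon>" by linarith
  qed (use g v in \<open>auto intro!: continuous_intros\<close>)
qed

lemma zero_avoidable_homeomorphic:
  assumes "zero_avoidable Z d" "Z homeomorphic_space Z'"
  shows "zero_avoidable Z' d"
proof -
  obtain h k where h: "continuous_map Z Z' h" and k: "continuous_map Z' Z k"
    and hk: "\<And>z. z \<in> topspace Z' \<Longrightarrow> h (k z) = z"
    using assms(2) unfolding homeomorphic_space_def homeomorphic_maps_def by blast
  show ?thesis
    unfolding zero_avoidable_def
  proof (intro allI impI)
    fix J :: "nat set" and f :: "nat \<Rightarrow> _ \<Rightarrow> real" and \<epsilon> :: real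
    assume J: "finite J" "card J = d" "0 < \<epsilon>" "\<forall>j\<in>J. continuous_map Z' euclideanreal (f j)"
    then have "\<forall>j\<in>J. continuous_map Z euclideanreal (f j \<circ> h)"
      using h continuous_map_compose by blast
    then obtain g where g: "\<forall>j\<in>J. continuous_map Z euclideanreal (g j) \<and>
        (\<forall>z\<in>topspace Z. \<bar>g j z - (f j \<circ> h) z\<bar> < \<epsilon>)" "\<forall>z\<in>topspace Z. \<exists>j\<in>J. g j z \<noteq> 0"
      using assms(1)[unfolded zero_avoidable_def, rule_format, OF J(1-3), of "\<lambda>j. f j \<circ> h"] by blast
    have kz: "k z \<in> topspace Z" if "z \<in> topspace Z'" for z
      using k that continuous_map_image_subset_topspace by fastforce
    show "\<exists>g. (\<forall>j\<in>J. continuous_map Z' euclideanreal (g j) \<and> (\<forall>z\<in>topspace Z'. \<bar>g j z - f j z\<bar> < \<epsilon>)) \<and>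
             (\<forall>z\<in>topspace Z'. \<exists>j\<in>J. g j z \<noteq> 0)"
    proof (intro exI[of _ "\<lambda>j. g j \<circ> k"] conjI ballI)
      fix j z assume "j \<in> J" "z \<in> topspace Z'"
      then show "\<bar>(g j \<circ> k) z - f j z\<bar> < \<epsilon>"
        using g(1) kz[of z] hk[of z] by (metis comp_apply)
    qed (use g k kz in \<open>auto intro: continuous_map_compose\<close>)
  qed
qed

text \<open>This is the finite sum theorem of dimension theory.  The pieces are treated one after the other:
  avoiding zero on a compact set survives further small perturbations, and a perturbation on a
  new piece extends to the whole space, without growing, by Tietze's theorem.\<close>

lemma zero_avoidable_closed_cover:
  assumes Z: "compact_space Z" "Hausdorff_space Z"
    and fin: "finite \<C>" and closed: "\<And>C. C \<in> \<C> \<Longrightarrow> closedin Z C"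
    and avoid: "\<And>C. C \<in> \<C> \<Longrightarrow> zero_avoidable (subtopology Z C) d"
    and cover: "topspace Z \<subseteq> \<Union>\<C>"
  shows "zero_avoidable Z d"
proof -
  have normal: "normal_space Z"
    using Z by (simp add: compact_Hausdorff_or_regular_imp_normal_space)
  have main: "\<exists>g. (\<forall>j\<in>J. continuous_map Z euclideanreal (g j) \<and> (\<forall>z\<in>topspace Z. \<bar>g j z - f j z\<bar> < \<epsilon>)) \<and>
             (\<forall>z\<in>\<Union>\<C>. \<exists>j\<in>J. g j z \<noteq> 0)"
    if J: "finite J" "card J = d" and "0 < \<epsilon>" and f: "\<forall>j\<in>J. continuous_map Z euclideanreal (f j)"
    for J :: "nat set" and f and \<epsilon> :: real
    using fin closed avoid
  proof (induction \<C>)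
    case empty
    then show ?case using f \<open>0 < \<epsilon>\<close> by (intro exI[of _ f]) auto
  next
    case (insert C \<C>)
    then obtain g where g: "\<And>j. j \<in> J \<Longrightarrow> continuous_map Z euclideanreal (g j)"
        "\<And>j z. j \<in> J \<Longrightarrow> z \<in> topspace Z \<Longrightarrow> \<bar>g j z - f j z\<bar> < \<epsilon>"
      and nz: "\<And>z. z \<in> \<Union>\<C> \<Longrightarrow> \<exists>j\<in>J. g j z \<noteq> 0"
      by (metis (no_types, lifting) insertCI)
    have Ccl: "closedin Z C" "C \<subseteq> topspace Z"
      using insert.prems(1) closedin_subset by auto
    \<comment> \<open>\<open>\<eta>\<close> and \<open>\<epsilon>1\<close> measure how far \<open>g\<close> may still be moved: it has to avoid zero on the pieces
      treated so far, and to remain \<open>\<epsilon>\<close>-close to \<open>f\<close>.\<close>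
    obtain \<eta> where \<eta>: "0 < \<eta>" "\<And>z. z \<in> \<Union>\<C> \<Longrightarrow> \<eta> \<le> (\<Sum>j\<in>J. \<bar>g j z\<bar>)"
    proof (cases "\<Union>\<C> = {}")
      case False
      have "closedin Z (\<Union>\<C>)" using insert by (auto intro: closedin_Union)
      then have "compactin Z (\<Union>\<C>)" using Z(1) closedin_compact_space by blast
      moreover have cs: "continuous_map Z euclideanreal (\<lambda>z. \<Sum>j\<in>J. \<bar>g j z\<bar>)"
        using g J(1) by (intro continuous_intros) auto
      ultimately have "compact ((\<lambda>z. \<Sum>j\<in>J. \<bar>g j z\<bar>) ` \<Union>\<C>)"
        using image_compactin by fastforce
      then obtain z0 where z0: "z0 \<in> \<Union>\<C>" "\<And>z. z \<in> \<Union>\<C> \<Longrightarrow> (\<Sum>j\<in>J. \<bar>g j z0\<bar>) \<le> (\<Sum>j\<in>J. \<bar>g j z\<bar>)"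
        using compact_attains_inf[of "(\<lambda>z. \<Sum>j\<in>J. \<bar>g j z\<bar>) ` \<Union>\<C>"] False by auto
      obtain j where "j \<in> J" "g j z0 \<noteq> 0" using nz z0(1) by blast
      then have "0 < (\<Sum>j\<in>J. \<bar>g j z0\<bar>)"
        using J(1) by (intro sum_pos2[of J j]) auto
      then show ?thesis using z0(2) by (rule that)
    qed (use that[of 1] in auto)
    have "\<exists>\<epsilon>1>0. \<forall>j\<in>J. \<forall>z\<in>topspace Z. \<bar>g j z - f j z\<bar> + \<epsilon>1 < \<epsilon>"
    proof (cases "J = {} \<or> topspace Z = {}")
      case False
      have "\<exists>e>0. \<forall>z\<in>topspace Z. \<bar>g j z - f j z\<bar> + e < \<epsilon>" if j: "j \<in> J" for j
      proof -
        have "continuous_map Z euclideanreal (\<lambda>z. \<bar>g j z - f j z\<bar>)"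
          using g f j by (intro continuous_intros) auto
        then have "compact ((\<lambda>z. \<bar>g j z - f j z\<bar>) ` topspace Z)"
          using image_compactin Z(1) unfolding compact_space_def by fastforce
        then obtain z0 where z0: "z0 \<in> topspace Z" "\<And>z. z \<in> topspace Z \<Longrightarrow> \<bar>g j z - f j z\<bar> \<le> \<bar>g j z0 - f j z0\<bar>"
          using compact_attains_sup[of "(\<lambda>z. \<bar>g j z - f j z\<bar>) ` topspace Z"] False by auto
        have "\<bar>g j z0 - f j z0\<bar> < \<epsilon>" using g(2) j z0(1) by blast
        then show ?thesis
          using z0(2) by (intro exI[of _ "(\<epsilon> - \<bar>g j z0 - f j z0\<bar>) / 2"]) (fastforce simp: field_simps)
      qed
      then obtain e where e: "\<And>j. j \<in> J \<Longrightarrow> 0 < e j"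
         "\<And>j z. j \<in> J \<Longrightarrow> z \<in> topspace Z \<Longrightarrow> \<bar>g j z - f j z\<bar> + e j < \<epsilon>" by metis
      have "0 < Min (e ` J)" using e(1) J(1) False by simp
      moreover have "\<bar>g j z - f j z\<bar> + Min (e ` J) < \<epsilon>" if "j \<in> J" "z \<in> topspace Z" for j z
      proof -
        have "Min (e ` J) \<le> e j" using J(1) that by simp
        then show ?thesis using e(2)[OF that] by linarith
      qed
      ultimately show ?thesis by blast
    qed (use \<open>0 < \<epsilon>\<close> in \<open>auto intro: exI[of _ 1]\<close>)
    then obtain \<epsilon>1 where \<epsilon>1: "0 < \<epsilon>1" "\<And>j z. j \<in> J \<Longrightarrow> z \<in> topspace Z \<Longrightarrow> \<bar>g j z - f j z\<bar> + \<epsilon>1 < \<epsilon>"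
      by blast
    define \<epsilon>2 where "\<epsilon>2 = min \<epsilon>1 (\<eta> / (real (card J) + 1))"
    have "0 < \<epsilon>2" using \<epsilon>1 \<eta> by (simp add: \<epsilon>2_def)
    have "real (card J) * \<epsilon>2 < \<eta>"
    proof -
      have "real (card J) * \<epsilon>2 \<le> real (card J) * (\<eta> / (real (card J) + 1))"
        by (intro mult_left_mono) (auto simp: \<epsilon>2_def)
      also have "\<dots> < \<eta>" using \<eta>(1) by (simp add: field_simps)
      finally show ?thesis .
    qed
    have "zero_avoidable (subtopology Z C) d" using insert.prems by auto
    moreover have "\<forall>j\<in>J. continuous_map (subtopology Z C) euclideanreal (g j)"
      using g(1) continuous_map_from_subtopology by blast
    ultimately obtain u where u: "\<And>j. j \<in> J \<Longrightarrow> continuous_map (subtopology Z C) euclideanreal (u j)"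
        "\<And>j z. j \<in> J \<Longrightarrow> z \<in> C \<Longrightarrow> \<bar>u j z - g j z\<bar> < \<epsilon>2"
        "\<And>z. z \<in> C \<Longrightarrow> \<exists>j\<in>J. u j z \<noteq> 0"
      using J \<open>0 < \<epsilon>2\<close> Ccl unfolding zero_avoidable_def
      by (metis (no_types, lifting) topspace_subtopology_subset)
    have "\<exists>w. continuous_map Z euclideanreal w \<and> (\<forall>z\<in>C. w z = u j z - g j z) \<and> 
          (\<forall>z\<in>topspace Z. \<bar>w z\<bar> \<le> \<epsilon>2)" if j: "j \<in> J" for j
    proof -
      have c1: "continuous_map (subtopology Z C) euclideanreal (\<lambda>z. u j z - g j z)"
        using u(1)[OF j] continuous_map_from_subtopology[OF g(1)[OF j]] by (rule continuous_map_diff)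
      have c2: "(\<lambda>z. u j z - g j z) ` C \<subseteq> {-\<epsilon>2..\<epsilon>2}"
        using u(2)[OF j] by (fastforce simp: abs_less_iff)
      have c3: "-\<epsilon>2 \<le> \<epsilon>2" using \<open>0 < \<epsilon>2\<close> by simp
      obtain w where w: "continuous_map Z euclideanreal w" "\<And>z. z \<in> C \<Longrightarrow> w z = u j z - g j z"
          "w ` topspace Z \<subseteq> {-\<epsilon>2..\<epsilon>2}"
        by (rule Tietze_extension_closed_real_interval[OF normal Ccl(1) c1 c2 c3]) (rule that; fast)
      have "\<bar>w z\<bar> \<le> \<epsilon>2" if "z \<in> topspace Z" for z
      proof -
        have "w z \<in> {-\<epsilon>2..\<epsilon>2}" using w(3) that by blast
        then show ?thesis by auto
      qed
      with w show ?thesis by blast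
    qed
    then obtain w where w: "\<And>j. j \<in> J \<Longrightarrow> continuous_map Z euclideanreal (w j)"
       "\<And>j z. j \<in> J \<Longrightarrow> z \<in> C \<Longrightarrow> w j z = u j z - g j z"
       "\<And>j z. j \<in> J \<Longrightarrow> z \<in> topspace Z \<Longrightarrow> \<bar>w j z\<bar> \<le> \<epsilon>2"
      by metis
    show ?case
    proof (intro exI[of _ "\<lambda>j z. g j z + w j z"] conjI ballI)
      fix j assume j: "j \<in> J"
      show "continuous_map Z euclideanreal (\<lambda>z. g j z + w j z)"
        using g(1)[OF j] w(1)[OF j] by (rule continuous_map_add)
      fix z assume z: "z \<in> topspace Z"
      show "\<bar>g j z + w j z - f j z\<bar> < \<epsilon>"
        using \<epsilon>1(2)[OF j z] w(3)[OF j z] by (auto simp: \<epsilon>2_def)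
    next
      fix z assume z: "z \<in> \<Union>(insert C \<C>)"
      show "\<exists>j\<in>J. g j z + w j z \<noteq> 0"
      proof (cases "z \<in> C")
        case True
        then show ?thesis using u(3) w(2) by force
      next
        case False
        with z have z': "z \<in> \<Union>\<C>" by blast
        then have zt: "z \<in> topspace Z" using insert.prems(1) closedin_subset by blast
        show ?thesis
        proof (rule ccontr)
          assume "\<not> ?thesis"
          then have "\<bar>g j z\<bar> \<le> \<epsilon>2" if "j \<in> J" for j
            using w(3)[OF that zt] that by (metis abs_minus_cancel add_eq_0_iff)
          then have "(\<Sum>j\<in>J. \<bar>g j z\<bar>) \<le> (\<Sum>j\<in>J. \<epsilon>2)" by (rule sum_mono)
          also have "\<dots> < \<eta>" using \<open>real (card J) * \<epsilon>2 < \<eta>\<close> by simp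
          finally show False using \<eta>(2)[OF z'] by simp
        qed
      qed
    qed
  qed
  show ?thesis
    unfolding zero_avoidable_def
  proof (intro allI impI)
    fix J :: "nat set" and f :: "nat \<Rightarrow> 'a \<Rightarrow> real" and \<epsilon> :: real
    assume "finite J" "card J = d" "0 < \<epsilon>" "\<forall>j\<in>J. continuous_map Z euclideanreal (f j)"
    from main[OF this]
    show "\<exists>g. (\<forall>j\<in>J. continuous_map Z euclideanreal (g j) \<and> (\<forall>z\<in>topspace Z. \<bar>g j z - f j z\<bar> < \<epsilon>)) \<and>
             (\<forall>z\<in>topspace Z. \<exists>j\<in>J. g j z \<noteq> 0)"
      by (rule ex_forward, elim conjE, intro conjI ballI) (use cover in auto)
  qed
qed

section \<open>Pushing maps into a skeleton of the simplex\<close>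

lemma continuous_map_Min:
  fixes f :: "'j \<Rightarrow> 'z \<Rightarrow> real"
  assumes "finite J" "J \<noteq> {}" "\<And>j. j \<in> J \<Longrightarrow> continuous_map Z euclideanreal (f j)"
  shows "continuous_map Z euclideanreal (\<lambda>z. Min ((\<lambda>j. f j z) ` J))"
  using assms
proof (induction rule: finite_ne_induct)
  case (insert j J)
  then have "continuous_map Z euclideanreal (\<lambda>z. min (f j z) (Min ((\<lambda>j. f j z) ` J)))"
    by (intro continuous_map_real_min) auto
  with insert show ?case by simp
qed simp

definition vertex_support :: "(nat \<Rightarrow> real) \<Rightarrow> nat set" where
  "vertex_support s = {i. 0 < s i}"

lemma vertex_support_simplex_face:
  assumes "s \<in> simplex_face I"
  shows "vertex_support s \<subseteq> I"
  using assms by (force simp: vertex_support_def simplex_face_def)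

text \<open>Let \<open>m\<close> be the largest number such that subtracting \<open>m F\<close> from the coordinates in \<open>J\<close> keeps them
  nonnegative.  Subtracting \<open>m F\<close> and renormalising is the radial projection of the simplex on \<open>J\<close>
  away from the point proportional to \<open>F\<close>; it fixes the boundary, where \<open>m = 0\<close>.  The centre of the
  projection may depend on \<open>z\<close>, provided that \<open>H z\<close> never meets it.  To achieve this, the
  coordinates of \<open>H\<close>, cut off below at \<open>\<delta>\<close>, are divided by a perturbation \<open>G\<close> of themselves that is
  at no point constant in \<open>j\<close>: the quotient \<open>F\<close> is close to 1, and if \<open>H z\<close> were proportional
  to it, then \<open>G\<close> would be constant in \<open>j\<close>.  Such a \<open>G\<close> exists because constancy in \<open>j\<close> is the common vanishing of
  \<open>card J - 1\<close> differences.\<close>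

lemma push_off_maximal_face:
  fixes H :: "'z \<Rightarrow> nat \<Rightarrow> real"
  assumes avoid: "zero_avoidable Z (card J - 1)"
    and J: "2 \<le> card J" "J \<subseteq> I" and I: "finite I"
    and cont: "continuous_map Z (powertop_real UNIV) H"
    and simplex: "\<And>z. z \<in> topspace Z \<Longrightarrow> H z \<in> simplex_face I"
    and maximal: "\<And>z. z \<in> topspace Z \<Longrightarrow> J \<subseteq> vertex_support (H z) \<Longrightarrow> vertex_support (H z) = J"
  shows "\<exists>H'. continuous_map Z (powertop_real UNIV) H' \<and>
     (\<forall>z\<in>topspace Z. H' z \<in> simplex_face I \<and> vertex_support (H' z) \<subseteq> vertex_support (H z) \<and>
        vertex_support (H' z) \<noteq> J \<and> (vertex_support (H z) \<noteq> J \<longrightarrow> H' z = H z))"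
proof -
  have finJ: "finite J" using J I finite_subset by blast
  obtain j0 where j0: "j0 \<in> J" using J(1) by fastforce
  have Hc: "continuous_map Z euclideanreal (\<lambda>z. H z j)" for j
    using cont by (simp add: continuous_map_componentwise_UNIV)
  have H0: "0 \<le> H z j" if "z \<in> topspace Z" for z j
    using simplex[OF that] by (simp add: simplex_face_def)
  have HI: "(\<Sum>i\<in>I. H z i) = 1" if "z \<in> topspace Z" for z
    using simplex[OF that] by (simp add: simplex_face_def)
  \<comment> \<open>A point of the simplex on \<open>J\<close> proportional to some \<open>F\<close> with values in the interval from 2/3 to 2 has
    all coordinates at least \<open>\<delta>\<close>, so that the cut-off does not affect it.\<close>
  define \<delta> where "\<delta> = 1 / (3 * real (card J))"
  have "0 < \<delta>" using J(1) by (simp add: \<delta>_def)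
  define a where "a j z = max (H z j) \<delta>" for j z
  have ac: "continuous_map Z euclideanreal (a j)" for j
    unfolding a_def by (intro continuous_intros Hc) auto
  have a\<delta>: "\<delta> \<le> a j z" for j z by (simp add: a_def)
  have "\<exists>g. (\<forall>j\<in>J-{j0}. continuous_map Z euclideanreal (g j) \<and>
               (\<forall>z\<in>topspace Z. \<bar>g j z - (a j z - a j0 z)\<bar> < \<delta> / 2)) \<and>
           (\<forall>z\<in>topspace Z. \<exists>j\<in>J-{j0}. g j z \<noteq> 0)"
    using avoid[unfolded zero_avoidable_def, rule_format, of "J - {j0}" "\<delta> / 2" "\<lambda>j z. a j z - a j0 z"]
      finJ j0 \<open>0 < \<delta>\<close> ac by (simp add: continuous_map_diff)
  then obtain g where g: "\<And>j. j \<in> J \<Longrightarrow> j \<noteq> j0 \<Longrightarrow> continuous_map Z euclideanreal (g j)"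
      "\<And>j z. j \<in> J \<Longrightarrow> j \<noteq> j0 \<Longrightarrow> z \<in> topspace Z \<Longrightarrow> \<bar>g j z - (a j z - a j0 z)\<bar> < \<delta> / 2"
    and nz: "\<And>z. z \<in> topspace Z \<Longrightarrow> \<exists>j\<in>J-{j0}. g j z \<noteq> 0"
    by blast
  define G where "G j z = a j0 z + (if j = j0 then 0 else g j z)" for j z
  have Gc: "continuous_map Z euclideanreal (G j)" if "j \<in> J" for j
    using g(1)[OF that] ac unfolding G_def by (cases "j = j0") (auto intro!: continuous_intros)
  have Ga: "\<bar>G j z - a j z\<bar> \<le> a j z / 2" if "j \<in> J" "z \<in> topspace Z" for j z
  proof (cases "j = j0")
    case False
    then have "G j z - a j z = g j z - (a j z - a j0 z)" by (simp add: G_def)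
    then show ?thesis using g(2)[OF that(1) False that(2)] a\<delta>[of j z] by linarith
  qed (use a\<delta>[of j z] \<open>0 < \<delta>\<close> in \<open>simp add: G_def\<close>)
  have Gpos: "0 < G j z" if "j \<in> J" "z \<in> topspace Z" for j z
    using Ga[OF that] a\<delta>[of j z] \<open>0 < \<delta>\<close> by linarith
  define F where "F j z = a j z / G j z" for j z
  have Fc: "continuous_map Z euclideanreal (F j)" if "j \<in> J" for j
    unfolding F_def using ac Gc Gpos that by (intro continuous_map_real_divide) (auto simp: less_imp_neq[symmetric])
  have F: "2 / 3 \<le> F j z" "F j z \<le> 2" if "j \<in> J" "z \<in> topspace Z" for j z
  proof -
    have "G j z \<le> 3 / 2 * a j z" "a j z \<le> 2 * G j z"
      using Ga[OF that] by linarith+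
    then show "2 / 3 \<le> F j z" "F j z \<le> 2"
      using Gpos[OF that] by (simp_all add: F_def field_simps)
  qed
  define m where "m z = Min ((\<lambda>j. H z j / F j z) ` J)" for z
  have mc: "continuous_map Z euclideanreal m"
    unfolding m_def using finJ j0 Hc Fc F(1)
    by (intro continuous_map_Min continuous_map_real_divide) (auto, fastforce)
  have m_le: "m z * F j z \<le> H z j" if "j \<in> J" "z \<in> topspace Z" for j z
  proof -
    have "m z \<le> H z j / F j z" unfolding m_def using finJ that by simp
    then show ?thesis using F(1)[OF that] by (simp add: field_simps)
  qed
  have m_attained: "\<exists>j\<in>J. H z j = m z * F j z" if "z \<in> topspace Z" for z
  proof -
    have "m z \<in> (\<lambda>j. H z j / F j z) ` J" unfolding m_def using finJ j0 by (intro Min_in) auto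
    then obtain j where "j \<in> J" "m z = H z j / F j z" by blast
    then show ?thesis using F(1)[of j z] that by (intro bexI[of _ j]) auto
  qed
  have m0: "0 \<le> m z" if "z \<in> topspace Z" for z
  proof -
    obtain j where j: "j \<in> J" "H z j = m z * F j z" using m_attained[OF \<open>z \<in> topspace Z\<close>] by blast
    have "0 \<le> m z * F j z" using H0[OF \<open>z \<in> topspace Z\<close>, of j] j(2) by simp
    moreover have "0 < F j z" using F(1)[OF j(1) \<open>z \<in> topspace Z\<close>] by linarith
    ultimately show ?thesis by (simp add: zero_le_mult_iff)
  qed
  define D where "D z j = H z j - (if j \<in> J then m z * F j z else 0)" for z j
  have D0: "0 \<le> D z j" "D z j \<le> H z j" if "z \<in> topspace Z" for z j
    using m_le[of j z] m0[of z] H0[of z j] F(1)[of j z] that by (auto simp: D_def intro!: mult_nonneg_nonneg)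
  have D_eq: "D z = H z" if z: "z \<in> topspace Z" and "vertex_support (H z) \<noteq> J" for z
  proof -
    have "\<not> J \<subseteq> vertex_support (H z)" using maximal[OF z] that(2) by blast
    then obtain j where "j \<in> J" "H z j = 0"
      using H0[OF z] by (auto simp: vertex_support_def less_le)
    then have "m z = 0" using m_le[of j z] m0[OF z] F(1)[of j z] z
      by (smt (verit, best) mult_pos_pos divide_pos_pos)
    then show ?thesis by (auto simp: D_def)
  qed
  define T where "T z = (\<Sum>i\<in>I. D z i)" for z
  have T_eq: "T z = 1" if "z \<in> topspace Z" "vertex_support (H z) \<noteq> J" for z
    using D_eq[OF that] HI[OF that(1)] by (simp add: T_def)
  have Tpos: "0 < T z" if z: "z \<in> topspace Z" for z
  proof (cases "vertex_support (H z) = J")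
    case True
    show ?thesis
    proof (rule ccontr)
      assume "\<not> 0 < T z"
      then have "T z = 0" using D0(1)[OF z] by (simp add: T_def order_antisym sum_nonneg not_less)
      then have D0': "D z i = 0" if "i \<in> I" for i
        using that I D0(1)[OF z] by (simp add: T_def sum_nonneg_eq_0_iff)
      then have HF: "H z j = m z * F j z" if "j \<in> J" for j
        using that J(2) by (force simp: D_def)
      have "1 = (\<Sum>j\<in>J. H z j)"
      proof -
        have "H z i = 0" if "i \<notin> J" for i
          using True H0[OF z] that by (force simp: vertex_support_def less_le)
        then have "(\<Sum>j\<in>J. H z j) = (\<Sum>i\<in>I. H z i)"
          using J(2) I by (intro sum.mono_neutral_left) auto
        then show ?thesis using HI[OF z] by simp
      qed
      also have "\<dots> = (\<Sum>j\<in>J. m z * F j z)" using HF by (rule sum.cong[OF refl])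
      also have "\<dots> \<le> (\<Sum>j\<in>J. m z * 2)"
        using F(2) z m0[OF z] by (intro sum_mono mult_left_mono) auto
      finally have "1 \<le> real (card J) * (m z * 2)" by simp
      then have "\<delta> \<le> m z * (2 / 3)"
        using J(1) by (simp add: \<delta>_def field_simps)
      then have "\<delta> \<le> H z j" if "j \<in> J" for j
        using HF[OF that] F(1)[OF that z] m0[OF z] mult_left_mono by fastforce
      then have "a j z = m z * F j z" if "j \<in> J" for j
        using HF that by (simp add: a_def)
      then have "G j z = m z" if "j \<in> J" for j
      proof -
        have "a j z = m z * (a j z / G j z)" using \<open>\<And>j. j \<in> J \<Longrightarrow> a j z = m z * F j z\<close>[OF that] by (simp add: F_def)
        moreover have "0 < a j z" using a\<delta>[of j z] \<open>0 < \<delta>\<close> by linarith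
        ultimately show ?thesis using Gpos[OF that z] by (simp add: field_simps)
      qed
      moreover obtain j where "j \<in> J" "j \<noteq> j0" "g j z \<noteq> 0" using nz[OF z] by blast
      ultimately have "G j z = G j0 z" "g j z \<noteq> 0" "j \<noteq> j0" using j0 by auto
      then show False by (simp add: G_def)
    qed
  qed (use T_eq[OF z] in simp)
  have Dc: "continuous_map Z euclideanreal (\<lambda>z. D z i)" for i
    unfolding D_def using Hc mc Fc by (cases "i \<in> J") (auto intro!: continuous_intros)
  have Tc: "continuous_map Z euclideanreal T"
    unfolding T_def using Dc I by (intro continuous_intros) auto
  define H' where "H' z j = D z j / T z" for z j
  show ?thesis
  proof (intro exI[of _ H'] conjI ballI impI)
    show "continuous_map Z (powertop_real UNIV) H'"
      unfolding H'_def continuous_map_componentwise_UNIV using Dc Tc Tpos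
      by (auto intro!: continuous_intros simp: less_imp_neq[symmetric])
  next
    fix z assume z: "z \<in> topspace Z"
    have "D z i = 0" if "i \<notin> I" for i
      using that J(2) simplex[OF z] by (auto simp: D_def simplex_face_def)
    then show "H' z \<in> simplex_face I"
      using Tpos[OF z] D0(1)[OF z] unfolding simplex_face_def H'_def
      by (auto simp: T_def simp flip: sum_divide_distrib)
    have sub: "0 < D z i" if "0 < H' z i" for i
      using that Tpos[OF z] by (simp add: H'_def zero_less_divide_iff)
    then show "vertex_support (H' z) \<subseteq> vertex_support (H z)"
      using D0(2)[OF z] unfolding vertex_support_def by (auto intro: less_le_trans)
    obtain j where "j \<in> J" "H z j = m z * F j z" using m_attained[OF z] by blast
    then have "D z j = 0" by (simp add: D_def)
    then have "j \<notin> vertex_support (H' z)"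
      using sub[of j] by (auto simp: vertex_support_def)
    then show "vertex_support (H' z) \<noteq> J" using \<open>j \<in> J\<close> by blast
    show "H' z = H z" if "vertex_support (H z) \<noteq> J"
      using D_eq[OF z that] T_eq[OF z that] by (auto simp: H'_def)
  qed
qed

text \<open>The supports of the points \<open>H z\<close> belong to a simplicial complex \<open>\<S>\<close>, initially the full simplex.
  A simplex of \<open>\<S>\<close> of maximal dimension is a maximal face; pushing \<open>H\<close> off it removes it from \<open>\<S>\<close>,
  and this is repeated until only the \<open>m\<close>-skeleton is left.\<close>

lemma push_into_skeleton:
  fixes H :: "'z \<Rightarrow> nat \<Rightarrow> real"
  assumes avoid: "\<And>d. m < d \<Longrightarrow> zero_avoidable Z d"
    and I: "finite I"
    and cont: "continuous_map Z (powertop_real UNIV) H"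
    and simplex: "\<And>z. z \<in> topspace Z \<Longrightarrow> H z \<in> simplex_face I"
  shows "\<exists>H'. continuous_map Z (powertop_real UNIV) H' \<and>
     (\<forall>z\<in>topspace Z. H' z \<in> simplex_face I \<and> vertex_support (H' z) \<subseteq> vertex_support (H z) \<and>
        card (vertex_support (H' z)) \<le> m + 1 \<and>
        (card (vertex_support (H z)) \<le> m + 1 \<longrightarrow> H' z = H z))"
proof -
  have "\<exists>H'. continuous_map Z (powertop_real UNIV) H' \<and>
     (\<forall>z\<in>topspace Z. H' z \<in> simplex_face I \<and> vertex_support (H' z) \<subseteq> vertex_support (H z) \<and>
        card (vertex_support (H' z)) \<le> m + 1 \<and>
        (card (vertex_support (H z)) \<le> m + 1 \<longrightarrow> H' z = H z))"
    if "\<S> \<subseteq> Pow I" "\<And>S T. S \<in> \<S> \<Longrightarrow> T \<subseteq> S \<Longrightarrow> T \<in> \<S>" 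
       "continuous_map Z (powertop_real UNIV) H"
       "\<And>z. z \<in> topspace Z \<Longrightarrow> H z \<in> simplex_face I"
       "\<And>z. z \<in> topspace Z \<Longrightarrow> vertex_support (H z) \<in> \<S>" for \<S> H
    using that
  proof (induction "card \<S>" arbitrary: \<S> H rule: less_induct)
    case less
    have fin: "finite \<S>" using less.prems(1) I by (meson finite_Pow_iff finite_subset)
    show ?case
    proof (cases "\<exists>J\<in>\<S>. m + 2 \<le> card J")
      case False
      then have "card (vertex_support (H z)) \<le> m + 1" if "z \<in> topspace Z" for z
        using less.prems(5)[OF that] by force
      then show ?thesis using less.prems by (intro exI[of _ H]) auto
    next
      case True
      define J where "J = (ARG_MAX card J. J \<in> \<S>)"
      obtain J1 where J1: "J1 \<in> \<S>" "m + 2 \<le> card J1" using True by blast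
      have bound: "\<forall>J. J \<in> \<S> \<longrightarrow> card J \<le> card I"
        using less.prems(1) I card_mono by blast
      then have J: "J \<in> \<S>" "\<And>S. S \<in> \<S> \<Longrightarrow> card S \<le> card J"
        using arg_max_nat_lemma[of "\<lambda>J. J \<in> \<S>" J1 card "Suc (card I)"] J1(1) 
        unfolding J_def by (auto simp: le_imp_less_Suc)
      have Jc: "m + 2 \<le> card J" using J(2)[OF J1(1)] J1(2) by linarith
      have "J \<subseteq> I" using J(1) less.prems(1) by blast
      have top: "S = J" if "S \<in> \<S>" "J \<subseteq> S" for S
      proof -
        have "finite S" using less.prems(1) that I finite_subset by blast
        then show ?thesis using card_seteq[of S J] J(2)[OF that(1)] that(2) by blast
      qed
      have za: "zero_avoidable Z (card J - 1)" and two: "2 \<le> card J"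
        using Jc by (auto intro: avoid)
      have max: "vertex_support (H z) = J" if "z \<in> topspace Z" "J \<subseteq> vertex_support (H z)" for z
        using top less.prems(5) that by blast
      obtain H1 where H1: "continuous_map Z (powertop_real UNIV) H1"
        and H1': "\<forall>z\<in>topspace Z. H1 z \<in> simplex_face I \<and> vertex_support (H1 z) \<subseteq> vertex_support (H z) \<and>
           vertex_support (H1 z) \<noteq> J \<and> (vertex_support (H z) \<noteq> J \<longrightarrow> H1 z = H z)"
        using push_off_maximal_face[OF za two \<open>J \<subseteq> I\<close> I less.prems(3,4) max] by auto
      have 1: "card (\<S> - {J}) < card \<S>" using fin J(1) by (meson card_Diff1_less)
      have 2: "\<S> - {J} \<subseteq> Pow I" using less.prems(1) by blast
      have 3: "T \<in> \<S> - {J}" if "S \<in> \<S> - {J}" "T \<subseteq> S" for S T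
        using that less.prems(2) top by blast
      have 4: "vertex_support (H1 z) \<in> \<S> - {J}" if "z \<in> topspace Z" for z
        using bspec[OF H1' that] less.prems(2)[OF less.prems(5)[OF that]] by auto
      have 5: "H1 z \<in> simplex_face I" if "z \<in> topspace Z" for z
        using H1' that by blast
      obtain H' where H': "continuous_map Z (powertop_real UNIV) H'"
        "\<forall>z\<in>topspace Z. H' z \<in> simplex_face I \<and> vertex_support (H' z) \<subseteq> vertex_support (H1 z) \<and>
          card (vertex_support (H' z)) \<le> m + 1 \<and>
          (card (vertex_support (H1 z)) \<le> m + 1 \<longrightarrow> H' z = H1 z)"
      proof -
        have "\<exists>H'. continuous_map Z (powertop_real UNIV) H' \<and>
          (\<forall>z\<in>topspace Z. H' z \<in> simplex_face I \<and> vertex_support (H' z) \<subseteq> vertex_support (H1 z) \<and>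
            card (vertex_support (H' z)) \<le> m + 1 \<and>
            (card (vertex_support (H1 z)) \<le> m + 1 \<longrightarrow> H' z = H1 z))"
          by (rule less.hyps[OF 1 2 _ H1]) (erule (1) 3, erule 5, erule 4)
        then show ?thesis using that by auto
      qed
      have "H' z = H z" if "z \<in> topspace Z" "card (vertex_support (H z)) \<le> m + 1" for z
      proof -
        have "H1 z = H z" using H1' that Jc by force
        then show ?thesis using H'(2) that by simp
      qed
      moreover have "vertex_support (H' z) \<subseteq> vertex_support (H z)" if "z \<in> topspace Z" for z
        using H1' H'(2) that by blast
      ultimately show ?thesis using H' by (intro exI[of _ H']) auto
    qed
  qed
  from this[of "Pow I" H, OF _ _ cont simplex] show ?thesis
    using vertex_support_simplex_face simplex by auto
qed

section \<open>Cells and subcomplexes\<close>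

definition radius :: "nat \<Rightarrow> (nat \<Rightarrow> real) \<Rightarrow> real" where
  "radius d y = sqrt (\<Sum>i<d. (y i)\<^sup>2)"

lemma topspace_unit_cell: "topspace (unit_cell d) = {y. (\<forall>i\<ge>d. y i = 0) \<and> radius d y \<le> 1}"
  by (auto simp: unit_cell_def topspace_Euclidean_space radius_def)

lemma unit_cell_interior_radius:
  "unit_cell_interior d = {y \<in> topspace (unit_cell d). radius d y < 1}"
  by (auto simp: unit_cell_interior_def radius_def)

lemma unit_cell_boundary_radius:
  "unit_cell_boundary d = {y \<in> topspace (unit_cell d). radius d y = 1}"
  by (auto simp: unit_cell_boundary_def radius_def)

lemma unit_cell_eq: "unit_cell d = subtopology (powertop_real UNIV) (topspace (unit_cell d))"
proof -
  have "topspace (unit_cell d) = {y. \<forall>i\<ge>d. y i = 0} \<inter> {y. (\<Sum>i<d. (y i)\<^sup>2) \<le> 1}"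
    by (auto simp: unit_cell_def topspace_Euclidean_space)
  then show ?thesis
    by (simp add: unit_cell_def Euclidean_space_def subtopology_subtopology)
qed

lemma continuous_map_coordinate_unit_cell:
  "continuous_map (unit_cell d) euclideanreal (\<lambda>y. y i)"
  by (subst unit_cell_eq) (intro continuous_map_from_subtopology continuous_map_product_projection UNIV_I)

lemma continuous_map_into_unit_cell:
  "continuous_map T (unit_cell d) f \<longleftrightarrow>
     (\<forall>i. continuous_map T euclideanreal (\<lambda>x. f x i)) \<and> f ` topspace T \<subseteq> topspace (unit_cell d)"
  by (subst unit_cell_eq) (auto simp: continuous_map_in_subtopology continuous_map_componentwise_UNIV)

lemma continuous_map_radius: "continuous_map (unit_cell d) euclideanreal (radius d)"
proof -
  have "continuous_map (unit_cell d) euclideanreal (\<lambda>y. \<Sum>i<d. (y i)\<^sup>2)"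
    by (intro continuous_map_sum continuous_map_real_pow continuous_map_coordinate_unit_cell) simp
  then have "continuous_map (unit_cell d) euclideanreal (sqrt \<circ> (\<lambda>y. \<Sum>i<d. (y i)\<^sup>2))"
    by (rule continuous_map_compose) (simp add: continuous_on_real_sqrt)
  then show ?thesis by (simp add: radius_def [abs_def] o_def)
qed

lemma radius_scale: "radius d (\<lambda>i. c * y i) = \<bar>c\<bar> * radius d y"
  by (simp add: radius_def power_mult_distrib real_sqrt_mult flip: sum_distrib_left)

lemma radius_nonneg: "0 \<le> radius d y"
  by (simp add: radius_def sum_nonneg)

lemma scale_in_unit_cell:
  assumes "y \<in> topspace (unit_cell d)" "\<bar>c\<bar> * radius d y \<le> 1"
  shows "(\<lambda>i. c * y i) \<in> topspace (unit_cell d)"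
  using assms by (auto simp: topspace_unit_cell radius_scale)

lemma unit_cell_coordinate_le: "y \<in> topspace (unit_cell d) \<Longrightarrow> \<bar>y i\<bar> \<le> 1"
proof (cases "i < d")
  case True
  assume y: "y \<in> topspace (unit_cell d)"
  have "(y i)\<^sup>2 \<le> (\<Sum>i<d. (y i)\<^sup>2)" using True by (intro member_le_sum) auto
  then have "\<bar>y i\<bar> \<le> radius d y" by (metis radius_def real_sqrt_abs real_sqrt_le_mono)
  then show ?thesis using y by (simp add: topspace_unit_cell)
qed (auto simp: topspace_unit_cell)

lemma compact_unit_cell: "compact (topspace (unit_cell d))"
proof -
  have "compactin (powertop_real UNIV) (PiE UNIV (\<lambda>i. {-1..1}))"
    by (simp add: compactin_PiE)
  then have c: "compact (PiE UNIV (\<lambda>i::nat. {-1..1::real}))"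
    by (simp add: euclidean_product_topology)
  have "continuous_on UNIV (\<lambda>y::nat \<Rightarrow> real. \<Sum>i<d. (y i)\<^sup>2)"
    by (intro continuous_intros continuous_on_product_coordinates)
  then have cl: "closed {y::nat \<Rightarrow> real. (\<Sum>i<d. (y i)\<^sup>2) \<le> 1}"
    using closed_Collect_le continuous_on_const by blast
  have "closed {y::nat \<Rightarrow> real. \<forall>i\<ge>d. y i = 0}"
    by (intro closed_Collect_all closed_Collect_imp closed_Collect_eq continuous_on_product_coordinates) auto
  with cl have "closed (topspace (unit_cell d))"
    by (simp add: topspace_unit_cell radius_def Collect_conj_eq closed_Int)
  moreover have "topspace (unit_cell d) \<subseteq> PiE UNIV (\<lambda>i. {-1..1})"
    using unit_cell_coordinate_le by (fastforce simp: abs_le_iff)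
  ultimately show ?thesis using c by (metis compact_Int_closed inf.absorb2)
qed

lemma compact_space_unit_cell: "compact_space (unit_cell d)"
proof -
  have "compactin (powertop_real UNIV) (topspace (unit_cell d))"
    using compact_unit_cell by (simp add: euclidean_product_topology)
  then show ?thesis
    using compact_space_subtopology unit_cell_eq by metis
qed

lemma finite_regular_cell_complexD:
  assumes "finite_regular_cell_complex X K dm"
  shows "Hausdorff_space X" "finite K" "pairwise disjnt K" "\<Union>K = topspace X"
    "\<And>e. e \<in> K \<Longrightarrow> \<exists>\<phi>. continuous_map (unit_cell (dm e)) X \<phi> \<and> embedding_map (unit_cell (dm e)) X \<phi> \<and>
        \<phi> ` unit_cell_interior (dm e) = e \<and> \<phi> ` unit_cell_boundary (dm e) \<subseteq> \<Union>{e'\<in>K. dm e' < dm e}"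
  using assms unfolding finite_regular_cell_complex_def by simp_all

text \<open>Each boundary point of the ball is a limit of interior points along a radius; hence the closed
  cell, the image of the ball, is the closure of the open cell.\<close>

lemma cell_chart:
  assumes X: "finite_regular_cell_complex X K dm" and "e \<in> K"
  shows "\<exists>\<phi>. continuous_map (unit_cell (dm e)) X \<phi> \<and> embedding_map (unit_cell (dm e)) X \<phi> \<and>
    \<phi> ` unit_cell_interior (dm e) = e \<and>
    \<phi> ` unit_cell_boundary (dm e) \<subseteq> \<Union>{e'\<in>K. dm e' < dm e} \<and>
    X closure_of e = \<phi> ` topspace (unit_cell (dm e))"
proof -
  let ?B = "topspace (unit_cell (dm e))"
  obtain \<phi> where \<phi>: "continuous_map (unit_cell (dm e)) X \<phi>" "embedding_map (unit_cell (dm e)) X \<phi>"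
    "\<phi> ` unit_cell_interior (dm e) = e"
    "\<phi> ` unit_cell_boundary (dm e) \<subseteq> \<Union>{e'\<in>K. dm e' < dm e}"
    using finite_regular_cell_complexD(5)[OF assms] by auto
  have "Hausdorff_space X" using X by (rule finite_regular_cell_complexD)
  have "compactin X (\<phi> ` ?B)"
    using \<phi>(1) compact_space_unit_cell image_compactin unfolding compact_space_def by blast
  then have "closedin X (\<phi> ` ?B)"
    using \<open>Hausdorff_space X\<close> by (rule compactin_imp_closedin[rotated])
  moreover have "e \<subseteq> \<phi> ` ?B"
    using \<phi>(3) by (auto simp: unit_cell_interior_def)
  ultimately have "X closure_of e \<subseteq> \<phi> ` ?B" by (simp add: closure_of_minimal)
  moreover have "\<phi> y \<in> X closure_of e" if y: "y \<in> ?B" for y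
  proof -
    have scaled: "(\<lambda>i. t * y i) \<in> ?B" if "t \<in> {0..1}" for t
      using that y radius_nonneg[of "dm e" y]
      by (intro scale_in_unit_cell) (auto simp: topspace_unit_cell intro: mult_le_one)
    then have "continuous_map (top_of_set {0..1}) (unit_cell (dm e)) (\<lambda>t i. t * y i)"
      unfolding continuous_map_into_unit_cell by (auto intro!: continuous_intros)
    then have c: "continuous_map (top_of_set {0..1}) X (\<phi> \<circ> (\<lambda>t i. t * y i))"
      using \<phi>(1) by (rule continuous_map_compose)
    have "1 \<in> (top_of_set {0..1::real}) closure_of {0..<1}"
      by (simp add: closure_of_subtopology Int_absorb1 atLeastLessThan_subseteq_atLeastAtMost_iff)
    then have "(\<phi> \<circ> (\<lambda>t i. t * y i)) 1 \<in> X closure_of ((\<phi> \<circ> (\<lambda>t i. t * y i)) ` {0..<1})"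
      using continuous_map_image_closure_subset[OF c] by blast
    moreover have "(\<phi> \<circ> (\<lambda>t i. t * y i)) ` {0..<1} \<subseteq> e"
    proof (rule image_subsetI)
      fix t :: real assume t: "t \<in> {0..<1}"
      have "t * radius (dm e) y \<le> t * 1"
        using t y by (intro mult_left_mono) (auto simp: topspace_unit_cell)
      then have "radius (dm e) (\<lambda>i. t * y i) < 1" using t by (simp add: radius_scale)
      then show "(\<phi> \<circ> (\<lambda>t i. t * y i)) t \<in> e"
        using scaled[of t] t \<phi>(3) by (auto simp: unit_cell_interior_radius)
    qed
    ultimately show ?thesis using closure_of_mono by fastforce
  qed
  ultimately have "X closure_of e = \<phi> ` ?B" by blast
  with \<phi> show ?thesis by blast
qed

lemma closure_of_cell_subset:
  assumes "finite_regular_cell_complex X K dm" "e \<in> K"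
  shows "X closure_of e \<subseteq> e \<union> \<Union>{e'\<in>K. dm e' < dm e}"
proof -
  obtain \<phi> where \<phi>: "\<phi> ` unit_cell_interior (dm e) = e"
    "\<phi> ` unit_cell_boundary (dm e) \<subseteq> \<Union>{e'\<in>K. dm e' < dm e}"
    "X closure_of e = \<phi> ` topspace (unit_cell (dm e))"
    using cell_chart[OF assms] by auto
  have "topspace (unit_cell (dm e)) = unit_cell_interior (dm e) \<union> unit_cell_boundary (dm e)"
    by (auto simp: unit_cell_interior_radius unit_cell_boundary_radius topspace_unit_cell)
  then show ?thesis using \<phi> by auto
qed

lemma cells_disjoint:
  assumes "finite_regular_cell_complex X K dm" "e \<in> K" "e' \<in> K" "x \<in> e" "x \<in> e'"
  shows "e = e'"
  using finite_regular_cell_complexD(3)[OF assms(1)] assms(2-5) unfolding pairwise_def disjnt_def by blast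

lemma cell_subset_closure:
  assumes "finite_regular_cell_complex X K dm" "e \<in> K"
  shows "e \<subseteq> X closure_of e"
  using assms by (intro closure_of_subset) (auto simp: finite_regular_cell_complex_def)

lemma closedin_subcomplex:
  assumes "finite_regular_cell_complex X K dm" "subcomplex X K L"
  shows "closedin X (\<Union>L)"
proof -
  have "\<Union>L = (\<Union>e\<in>L. X closure_of e)"
    using assms cell_subset_closure unfolding subcomplex_def by blast
  moreover have "finite L"
    using assms finite_subset finite_regular_cell_complexD(2) unfolding subcomplex_def by metis
  ultimately show ?thesis by (auto intro: closedin_Union)
qed

text \<open>The closure of any other cell adds to it only points of cells of smaller dimension, and so none of
  \<open>e\<close>.\<close>

lemma subcomplex_remove_top_cell:
  assumes X: "finite_regular_cell_complex X K dm" and L: "subcomplex X K L"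
    and e: "e \<in> L" "\<And>e'. e' \<in> L \<Longrightarrow> dm e' \<le> dm e"
  shows "subcomplex X K (L - {e})"
  unfolding subcomplex_def
proof (intro conjI ballI subsetI)
  fix e' x assume e': "e' \<in> L - {e}" and x: "x \<in> X closure_of e'"
  have K: "L \<subseteq> K" "e \<in> K" "e' \<in> K" using L e e' by (auto simp: subcomplex_def)
  have "x \<in> \<Union>L" using L e' x unfolding subcomplex_def by blast
  then obtain c where c: "c \<in> L" "x \<in> c" by blast
  have "c \<noteq> e"
  proof
    assume "c = e"
    consider "x \<in> e'" | c' where "c' \<in> K" "dm c' < dm e'" "x \<in> c'"
      using closure_of_cell_subset[OF X K(3)] x by blast
    then show False
    proof cases
      case 1
      then show False using cells_disjoint[OF X K(2,3)] c \<open>c = e\<close> e' by blast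
    next
      case 2
      then have "c' = e" using cells_disjoint[OF X _ K(2)] c \<open>c = e\<close> by blast
      then show False using 2 e(2)[of e'] e' by simp
    qed
  qed
  with c show "x \<in> \<Union>(L - {e})" by blast
qed (use L in \<open>auto simp: subcomplex_def\<close>)

lemma continuous_map_closed_union:
  assumes "closedin T P" "closedin T Q" "topspace T \<subseteq> P \<union> Q"
    and "continuous_map (subtopology T P) Y f" "continuous_map (subtopology T Q) Y f"
  shows "continuous_map T Y f"
  unfolding continuous_map_closedin
proof (intro conjI allI impI)
  have sub: "P \<subseteq> topspace T" "Q \<subseteq> topspace T" using assms closedin_subset by auto
  show "f \<in> topspace T \<rightarrow> topspace Y"
    using assms(3-5) sub by (fastforce simp: continuous_map_def Pi_iff)
  fix C assume "closedin Y C"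
  then have "closedin (subtopology T P) {x \<in> P. f x \<in> C}" "closedin (subtopology T Q) {x \<in> Q. f x \<in> C}"
    using assms(4,5) sub by (auto simp: continuous_map_closedin Int_absorb1)
  then have "closedin T ({x \<in> P. f x \<in> C} \<union> {x \<in> Q. f x \<in> C})"
    using assms(1,2) by (meson closedin_Un closedin_trans_full)
  moreover have "{x \<in> P. f x \<in> C} \<union> {x \<in> Q. f x \<in> C} = {x \<in> topspace T. f x \<in> C}"
    using assms(3) sub by blast
  ultimately show "closedin T {x \<in> topspace T. f x \<in> C}" by simp
qed

lemma simplex_face_mono:
  assumes "finite J" "I \<subseteq> J" "s \<in> simplex_face I"
  shows "s \<in> simplex_face J"
proof -
  have "sum s J = sum s I"
    using assms by (intro sum.mono_neutral_right) (auto simp: simplex_face_def)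
  then show ?thesis using assms by (auto simp: simplex_face_def)
qed

lemma simplex_face_convex:
  assumes "s \<in> simplex_face I" "t \<in> simplex_face I" "0 \<le> c" "c \<le> 1"
  shows "(\<lambda>i. c * s i + (1 - c) * t i) \<in> simplex_face I"
  using assms by (auto simp: simplex_face_def sum.distrib simp flip: sum_distrib_left)

lemma vertex_in_simplex_face:
  assumes "finite I" "v \<in> I"
  shows "(\<lambda>i. if i = v then 1 else 0) \<in> simplex_face I"
  using assms by (auto simp: simplex_face_def)

section \<open>Collapsing a cell complex with labels\<close>

text \<open>A strict section of \<open>snd\<close> on the homotopy co-limit rarely exists: for two closed intervals that
  meet in an end point, continuous barycentric coordinates supported in the intervals would
  have to jump there.  A labelled collapse of the complex \<open>L\<close> is a section up to homotopy.  The
  deformation \<open>h\<close> preserves every subcomplex, and \<open>s\<close> gives barycentric coordinates for the collapsed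
  points: \<open>s x\<close> only uses indices \<open>i\<close> such that \<open>h (1, x)\<close> belongs to the space of \<open>A i\<close>.  The cardinality bound
  places \<open>s\<close> in the skeleton whose dimension is that of \<open>L\<close>.\<close>

definition labelled_collapse ::
    "'a topology \<Rightarrow> 'a set set \<Rightarrow> ('a set \<Rightarrow> nat) \<Rightarrow> (nat \<Rightarrow> 'a set set) \<Rightarrow> nat set \<Rightarrow> 'a set set
      \<Rightarrow> (real \<times> 'a \<Rightarrow> 'a) \<Rightarrow> ('a \<Rightarrow> nat \<Rightarrow> real) \<Rightarrow> bool" where
  "labelled_collapse X K dm A I L h s \<longleftrightarrow>
     continuous_map (prod_topology (top_of_set {0..1}) (subtopology X (\<Union>L))) X h \<and>
     continuous_map (subtopology X (\<Union>L)) (powertop_real UNIV) s \<and>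
     (\<forall>x\<in>\<Union>L. h (0, x) = x) \<and>
     (\<forall>M t x. subcomplex X K M \<longrightarrow> t \<in> {0..1} \<longrightarrow> x \<in> \<Union>M \<longrightarrow> x \<in> \<Union>L \<longrightarrow> h (t, x) \<in> \<Union>M) \<and>
     (\<forall>x\<in>\<Union>L. s x \<in> simplex_face I) \<and>
     (\<forall>x\<in>\<Union>L. \<forall>i\<in>vertex_support (s x). h (1, x) \<in> \<Union>(A i)) \<and>
     (\<forall>e\<in>L. \<forall>x\<in>e. card (vertex_support (s x)) \<le> dm e + 1)"

lemma labelled_collapseD:
  assumes "labelled_collapse X K dm A I L h s"
  shows "continuous_map (prod_topology (top_of_set {0..1}) (subtopology X (\<Union>L))) X h"
    and "continuous_map (subtopology X (\<Union>L)) (powertop_real UNIV) s"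
    and "\<And>x. x \<in> \<Union>L \<Longrightarrow> h (0, x) = x"
    and "\<And>M t x. subcomplex X K M \<Longrightarrow> t \<in> {0..1} \<Longrightarrow> x \<in> \<Union>M \<Longrightarrow> x \<in> \<Union>L \<Longrightarrow> h (t, x) \<in> \<Union>M"
    and "\<And>x. x \<in> \<Union>L \<Longrightarrow> s x \<in> simplex_face I"
    and "\<And>x i. x \<in> \<Union>L \<Longrightarrow> i \<in> vertex_support (s x) \<Longrightarrow> h (1, x) \<in> \<Union>(A i)"
    and "\<And>e x. e \<in> L \<Longrightarrow> x \<in> e \<Longrightarrow> card (vertex_support (s x)) \<le> dm e + 1"
proof -
  note c = assms[unfolded labelled_collapse_def]
  note c1 = c[THEN conjunct2] note c2 = c1[THEN conjunct2] note c3 = c2[THEN conjunct2]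
  note c4 = c3[THEN conjunct2] note c5 = c4[THEN conjunct2] note c6 = c5[THEN conjunct2]
  show "continuous_map (prod_topology (top_of_set {0..1}) (subtopology X (\<Union>L))) X h" by (rule c[THEN conjunct1])
  show "continuous_map (subtopology X (\<Union>L)) (powertop_real UNIV) s" by (rule c1[THEN conjunct1])
  show "\<And>x. x \<in> \<Union>L \<Longrightarrow> h (0, x) = x" by (rule c2[THEN conjunct1, rule_format])
  show "\<And>M t x. subcomplex X K M \<Longrightarrow> t \<in> {0..1} \<Longrightarrow> x \<in> \<Union>M \<Longrightarrow> x \<in> \<Union>L \<Longrightarrow> h (t, x) \<in> \<Union>M"
    by (rule c3[THEN conjunct1, rule_format])
  show "\<And>x. x \<in> \<Union>L \<Longrightarrow> s x \<in> simplex_face I" by (rule c4[THEN conjunct1, rule_format])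
  show "\<And>x i. x \<in> \<Union>L \<Longrightarrow> i \<in> vertex_support (s x) \<Longrightarrow> h (1, x) \<in> \<Union>(A i)"
    by (rule c5[THEN conjunct1, rule_format])
  show "\<And>e x. e \<in> L \<Longrightarrow> x \<in> e \<Longrightarrow> card (vertex_support (s x)) \<le> dm e + 1" by (rule c6[rule_format])
qed

text \<open>The cell \<open>e\<close> is stretched radially.  At time \<open>t\<close> the concentric ball of radius \<open>1 / (1 + t)\<close> covers the
  whole cell, and the remaining collar runs through the homotopy \<open>h'\<close> that is given on the
  boundary.  The factor 2 in the definition of \<open>hB\<close> completes \<open>h'\<close> already at radius 3/4 when \<open>t = 1\<close>.
  Hence outside this radius the end point is that of the boundary point, and \<open>s\<close> can interpolate there
  from the coordinates of the boundary point to the vertex \<open>v\<close>, which is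
  the only label used further inside.  The interpolation enlarges the support by at most one index, while the
  dimension of \<open>e\<close> exceeds that of the boundary cells by at least one.\<close>

lemma labelled_collapse_extend_over_cell:
  fixes h' :: "real \<times> 'a \<Rightarrow> 'a" and s' :: "'a \<Rightarrow> nat \<Rightarrow> real"
  assumes X: "finite_regular_cell_complex X K dm"
    and L: "subcomplex X K L" and L': "subcomplex X K (L - {e})" and e: "e \<in> L"
    and collapse': "labelled_collapse X K dm A I (L - {e}) h' s'"
    and I: "finite I" "v \<in> I" and v: "e \<in> A v" "subcomplex X K (A v)"
  shows "\<exists>h s. labelled_collapse X K dm A I L h s"
proof -
  note collapse'D = labelled_collapseD[OF collapse']
  note h' = collapse'D(1) and s' = collapse'D(2) and h'0 = collapse'D(3) and h'M = collapse'D(4)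
    and s'I = collapse'D(5) and s'A = collapse'D(6) and s'card = collapse'D(7)
  let ?d = "dm e"
  let ?U = "unit_cell ?d"
  let ?B = "topspace ?U"
  let ?Y = "\<Union>(L - {e})"
  let ?\<rho> = "radius ?d"
  let ?T = "top_of_set {0..1::real}"
  have eK: "e \<in> K" using L e by (auto simp: subcomplex_def)
  obtain \<phi> where \<phi>: "continuous_map ?U X \<phi>" and emb: "embedding_map ?U X \<phi>"
    and inter: "\<phi> ` unit_cell_interior ?d = e"
    and bdry: "\<phi> ` unit_cell_boundary ?d \<subseteq> \<Union>{e'\<in>K. dm e' < dm e}"
    and clos: "X closure_of e = \<phi> ` ?B"
    using cell_chart[OF X eK] by auto
  define D where "D = \<phi> ` ?B"
  have Bsplit: "y \<in> unit_cell_interior ?d \<or> y \<in> unit_cell_boundary ?d" if "y \<in> ?B" for y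
    using that by (auto simp: unit_cell_interior_radius unit_cell_boundary_radius topspace_unit_cell)
  have "X closure_of e \<subseteq> \<Union>L" using L e unfolding subcomplex_def by blast
  then have DL: "D \<subseteq> \<Union>L" by (simp add: D_def clos)
  have Lsub: "\<Union>L \<subseteq> topspace X" "?Y \<subseteq> \<Union>L"
    using closedin_subset[OF closedin_subcomplex[OF X L]] by auto
  have closedD: "closedin X D" using clos closedin_closure_of by (simp add: D_def flip: clos)
  have UL: "\<Union>L = ?Y \<union> D"
  proof
    have "e \<subseteq> D" using inter by (auto simp: D_def unit_cell_interior_def)
    then show "\<Union>L \<subseteq> ?Y \<union> D" by blast
  qed (use DL in auto)
  have bdryY: "\<phi> y \<in> ?Y" if "y \<in> unit_cell_boundary ?d" for y
  proof -
    have "\<phi> y \<in> \<Union>{e'\<in>K. dm e' < dm e}" using bdry that by auto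
    then obtain c where c: "c \<in> K" "dm c < dm e" "\<phi> y \<in> c" by auto
    have "y \<in> ?B" using that by (simp add: unit_cell_boundary_def)
    then have "\<phi> y \<in> \<Union>L" using DL by (auto simp: D_def)
    then obtain c' where c': "c' \<in> L" "\<phi> y \<in> c'" by blast
    then have "c' = c" using cells_disjoint[OF X _ c(1)] c L by (auto simp: subcomplex_def)
    with c' c show ?thesis by blast
  qed
  have eY: "x \<notin> ?Y" if "x \<in> e" for x
  proof
    assume "x \<in> ?Y"
    then obtain c where "c \<in> L" "c \<noteq> e" "x \<in> c" by blast
    moreover have "c \<in> K" using L \<open>c \<in> L\<close> by (auto simp: subcomplex_def)
    ultimately show False using cells_disjoint[OF X eK, of c x] that by blast
  qed
  have "homeomorphic_map ?U (subtopology X D) \<phi>"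
    using emb by (simp add: embedding_map_def D_def)
  then obtain \<psi> where \<psi>: "continuous_map (subtopology X D) ?U \<psi>"
    and \<psi>\<phi>: "\<And>y. y \<in> ?B \<Longrightarrow> \<psi> (\<phi> y) = y" and \<phi>\<psi>0: "\<And>x. x \<in> topspace (subtopology X D) \<Longrightarrow> \<phi> (\<psi> x) = x"
    unfolding homeomorphic_map_maps homeomorphic_maps_def by blast
  have Dsub: "D \<subseteq> topspace X" using DL Lsub by blast
  have topD: "topspace (subtopology X D) = D" using Dsub by auto
  have \<phi>\<psi>: "\<phi> (\<psi> x) = x" if "x \<in> D" for x using \<phi>\<psi>0[unfolded topD] that by blast
  have \<psi>B: "\<psi> x \<in> ?B" if "x \<in> D" for x
    using \<psi> that topD continuous_map_image_subset_topspace by fastforce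
  have \<psi>bd: "\<psi> x \<in> unit_cell_boundary ?d" if "x \<in> D" "x \<in> ?Y" for x
  proof -
    have "\<psi> x \<notin> unit_cell_interior ?d"
    proof
      assume "\<psi> x \<in> unit_cell_interior ?d"
      then have "\<phi> (\<psi> x) \<in> e" using inter by blast
      then show False using \<phi>\<psi>[OF that(1)] that(2) eY by metis
    qed
    then show ?thesis using Bsplit[OF \<psi>B[OF that(1)]] by blast
  qed
  \<comment> \<open>radial projection to the boundary sphere, meaningful away from the centre\<close>
  define N where "N y = (\<lambda>i. inverse (?\<rho> y) * y i)" for y
  have N: "N y \<in> unit_cell_boundary ?d" if "y \<in> ?B" "0 < ?\<rho> y" for y
    unfolding unit_cell_boundary_radius N_def
    using that scale_in_unit_cell[of y ?d "inverse (?\<rho> y)"] by (simp add: radius_scale)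
  have NB: "N y \<in> ?B" if "y \<in> ?B" "0 < ?\<rho> y" for y
    using N[OF that] by (simp add: unit_cell_boundary_def)
  have N1: "N y = y" if "?\<rho> y = 1" for y using that by (simp add: N_def)
  have \<rho>1: "?\<rho> y \<le> 1" if "y \<in> ?B" for y using that by (simp add: topspace_unit_cell)
  have contN: "continuous_map (subtopology ?U {y \<in> ?B. c \<le> ?\<rho> y}) (subtopology X ?Y) (\<phi> \<circ> N)" if "0 < c" for c
  proof -
    let ?S = "subtopology ?U {y \<in> ?B. c \<le> ?\<rho> y}"
    have S: "y \<in> ?B \<and> 0 < ?\<rho> y" if "y \<in> topspace ?S" for y
      using that \<open>0 < c\<close> by auto
    have "continuous_map ?S euclideanreal (\<lambda>y. N y i)" for i
      unfolding N_def
    proof (intro continuous_map_real_mult continuous_map_real_inverse)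
      show "continuous_map ?S euclideanreal ?\<rho>" "continuous_map ?S euclideanreal (\<lambda>y. y i)"
        by (intro continuous_map_from_subtopology continuous_map_radius continuous_map_coordinate_unit_cell)+
      show "?\<rho> y \<noteq> 0" if "y \<in> topspace ?S" for y using S[OF that] by simp
    qed
    moreover have "N ` topspace ?S \<subseteq> ?B" using S NB by blast
    ultimately have "continuous_map ?S ?U N"
      unfolding continuous_map_into_unit_cell by blast
    then have "continuous_map ?S X (\<phi> \<circ> N)" using \<phi> by (rule continuous_map_compose)
    moreover have "(\<phi> \<circ> N) \<in> topspace ?S \<rightarrow> ?Y"
      using S N bdryY by auto
    ultimately show ?thesis by (rule continuous_map_into_subtopology)
  qed
  define hB where "hB p = (if (1 + fst p) * ?\<rho> (snd p) \<le> 1 then \<phi> (\<lambda>i. (1 + fst p) * snd p i)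
      else h' (min (fst p) (2 * ((1 + fst p) * ?\<rho> (snd p) - 1)), \<phi> (N (snd p))))" for p
  define sB where "sB y = (if ?\<rho> y \<le> 3/4 then (\<lambda>i. if i = v then 1 else 0)
      else (\<lambda>i. (4 * ?\<rho> y - 3) * s' (\<phi> (N y)) i + (1 - (4 * ?\<rho> y - 3)) * (if i = v then 1 else 0)))" for y
  define h where "h p = (if snd p \<in> ?Y then h' p else hB (fst p, \<psi> (snd p)))" for p
  define s where "s x = (if x \<in> ?Y then s' x else sB (\<psi> x))" for x
  have cfst: "continuous_map (prod_topology ?T ?U) euclideanreal fst"
    using continuous_map_fst[of ?T ?U] continuous_map_into_fulltopology by blast
  have csnd: "continuous_map (prod_topology ?T ?U) ?U snd" by (rule continuous_map_snd)
  have c\<rho>: "continuous_map (prod_topology ?T ?U) euclideanreal (\<lambda>p. ?\<rho> (snd p))"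
    using continuous_map_compose[OF csnd continuous_map_radius] by (simp add: o_def)
  have cyi: "continuous_map (prod_topology ?T ?U) euclideanreal (\<lambda>p. snd p i)" for i
    using continuous_map_compose[OF csnd continuous_map_coordinate_unit_cell] by (simp add: o_def)
  have cp: "continuous_map (prod_topology ?T ?U) euclideanreal (\<lambda>p. (1 + fst p) * ?\<rho> (snd p))"
    by (intro continuous_map_real_mult continuous_map_add cfst c\<rho>) simp
  have conthB: "continuous_map (prod_topology ?T ?U) X hB"
    unfolding hB_def
  proof (rule continuous_map_cases_le[OF cp])
    let ?S = "subtopology (prod_topology ?T ?U) {p \<in> topspace (prod_topology ?T ?U). (1 + fst p) * ?\<rho> (snd p) \<le> 1}"
    have "continuous_map ?S ?U (\<lambda>p i. (1 + fst p) * snd p i)"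
      unfolding continuous_map_into_unit_cell
    proof (intro conjI allI)
      fix i show "continuous_map ?S euclideanreal (\<lambda>p. (1 + fst p) * snd p i)"
        by (intro continuous_map_from_subtopology continuous_map_real_mult continuous_map_add cfst cyi) simp
      show "(\<lambda>p i. (1 + fst p) * snd p i) ` topspace ?S \<subseteq> ?B"
        by (auto intro!: scale_in_unit_cell)
    qed
    from continuous_map_compose[OF this \<phi>]
    show "continuous_map ?S X (\<lambda>p. \<phi> (\<lambda>i. (1 + fst p) * snd p i))" by (simp add: o_def)
  next
    let ?S = "subtopology (prod_topology ?T ?U) {p \<in> topspace (prod_topology ?T ?U). 1 \<le> (1 + fst p) * ?\<rho> (snd p)}"
    have S: "fst p \<in> {0..1} \<and> snd p \<in> ?B \<and> 1/2 \<le> ?\<rho> (snd p) \<and> 1 \<le> (1 + fst p) * ?\<rho> (snd p)"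
      if "p \<in> topspace ?S" for p
    proof -
      have p: "fst p \<in> {0..1}" "snd p \<in> ?B" "1 \<le> (1 + fst p) * ?\<rho> (snd p)" using that by auto
      have "(1 + fst p) * ?\<rho> (snd p) \<le> 2 * ?\<rho> (snd p)"
        using p radius_nonneg by (intro mult_right_mono) auto
      with p show ?thesis by auto
    qed
    have "continuous_map ?S ?T (\<lambda>p. min (fst p) (2 * ((1 + fst p) * ?\<rho> (snd p) - 1)))"
    proof (rule continuous_map_into_subtopology)
      show "continuous_map ?S euclideanreal (\<lambda>p. min (fst p) (2 * ((1 + fst p) * ?\<rho> (snd p) - 1)))"
        by (intro continuous_map_from_subtopology continuous_map_real_min continuous_map_real_mult_left
              continuous_map_diff cfst cp) simp
      show "(\<lambda>p. min (fst p) (2 * ((1 + fst p) * ?\<rho> (snd p) - 1))) \<in> topspace ?S \<rightarrow> {0..1}"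
        using S by fastforce
    qed
    moreover have "continuous_map ?S (subtopology X ?Y) (\<lambda>p. \<phi> (N (snd p)))"
    proof -
      have "continuous_map ?S (subtopology ?U {y \<in> ?B. 1/2 \<le> ?\<rho> y}) snd"
        by (intro continuous_map_into_subtopology continuous_map_from_subtopology continuous_map_snd)
           (use S in auto)
      from continuous_map_compose[OF this contN[of "1/2"]] show ?thesis by (simp add: o_def)
    qed
    ultimately have "continuous_map ?S (prod_topology ?T (subtopology X ?Y))
        (\<lambda>p. (min (fst p) (2 * ((1 + fst p) * ?\<rho> (snd p) - 1)), \<phi> (N (snd p))))"
      by (simp add: continuous_map_paired)
    from continuous_map_compose[OF this h']
    show "continuous_map ?S X (\<lambda>p. h' (min (fst p) (2 * ((1 + fst p) * ?\<rho> (snd p) - 1)), \<phi> (N (snd p))))"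
      by (simp add: o_def)
  next
    fix p assume p: "p \<in> topspace (prod_topology ?T ?U)" "(1 + fst p) * ?\<rho> (snd p) = 1"
    then have "0 < ?\<rho> (snd p)" using radius_nonneg[of ?d "snd p"] by (auto simp: less_le)
    moreover from this p(2) have "1 + fst p = inverse (?\<rho> (snd p))" by (simp add: field_simps)
    moreover have "0 \<le> fst p" "snd p \<in> ?B" using p by auto
    ultimately show "\<phi> (\<lambda>i. (1 + fst p) * snd p i) = h' (min (fst p) (2 * ((1 + fst p) * ?\<rho> (snd p) - 1)), \<phi> (N (snd p)))"
      using p(2) N bdryY h'0 by (simp add: N_def)
  qed simp
  have contsB: "continuous_map ?U (powertop_real UNIV) sB"
    unfolding sB_def
  proof (rule continuous_map_cases_le[OF continuous_map_radius])
    let ?S = "subtopology ?U {y \<in> ?B. 3/4 \<le> ?\<rho> y}"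
    have "continuous_map ?S (powertop_real UNIV) (s' \<circ> (\<phi> \<circ> N))"
      using contN[of "3/4"] s' by (auto intro: continuous_map_compose)
    then have "continuous_map ?S euclideanreal (\<lambda>y. s' (\<phi> (N y)) i)" for i
      by (simp add: continuous_map_componentwise_UNIV)
    moreover have "continuous_map ?S euclideanreal ?\<rho>"
      by (intro continuous_map_from_subtopology continuous_map_radius)
    ultimately show "continuous_map ?S (powertop_real UNIV)
       (\<lambda>y i. (4 * ?\<rho> y - 3) * s' (\<phi> (N y)) i + (1 - (4 * ?\<rho> y - 3)) * (if i = v then 1 else 0))"
      unfolding continuous_map_componentwise_UNIV
      by (intro allI continuous_map_add continuous_map_real_mult continuous_map_diff) auto
  next
    fix y assume "?\<rho> y = 3/4"
    then show "(\<lambda>i. if i = v then 1 else 0) =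
      (\<lambda>i. (4 * ?\<rho> y - 3) * s' (\<phi> (N y)) i + (1 - (4 * ?\<rho> y - 3)) * (if i = v then 1 else 0))"
    proof -
      have c: "4 * ?\<rho> y - 3 = 0" using \<open>?\<rho> y = 3/4\<close> by simp
      show ?thesis unfolding c by auto
    qed
  qed auto
  have h_D: "h (t, x) = hB (t, \<psi> x)" if "t \<in> {0..1}" "x \<in> D" for t x
  proof (cases "x \<in> ?Y")
    case True
    have \<rho>: "?\<rho> (\<psi> x) = 1" using \<psi>bd[OF that(2) True] by (simp add: unit_cell_boundary_radius)
    have x: "\<phi> (\<psi> x) = x" using \<phi>\<psi> that by blast
    have "hB (t, \<psi> x) = h' (t, x)"
      using that(1) h'0[OF True] x by (cases "t = 0") (auto simp: hB_def \<rho> N1)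
    then show ?thesis using True by (simp add: h_def)
  qed (simp add: h_def)
  have s_D: "s x = sB (\<psi> x)" if "x \<in> D" for x
  proof (cases "x \<in> ?Y")
    case True
    have \<rho>: "?\<rho> (\<psi> x) = 1" using \<psi>bd[OF that True] by (simp add: unit_cell_boundary_radius)
    have x: "\<phi> (\<psi> x) = x" using \<phi>\<psi> that by blast
    then show ?thesis using True by (simp add: s_def sB_def \<rho> N1)
  qed (simp add: s_def)
  let ?Z = "prod_topology ?T (subtopology X (\<Union>L))"
  have conth: "continuous_map ?Z X h"
  proof (rule continuous_map_closed_union)
    have "closedin ?Z ({0..1} \<times> ?Y)" "closedin ?Z ({0..1} \<times> D)"
      using closedin_subcomplex[OF X L'] closedD UL
      by (auto simp: closedin_prod_Times_iff closedin_subset_topspace intro!: closedin_subtopology_Int_closed)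
    then show "closedin ?Z ({0..1} \<times> ?Y)" "closedin ?Z ({0..1} \<times> D)" by auto
    show "topspace ?Z \<subseteq> {0..1} \<times> ?Y \<union> {0..1} \<times> D" using UL by auto
    have sub: "subtopology ?Z ({0..1} \<times> S) = prod_topology ?T (subtopology X S)" if "S \<subseteq> \<Union>L" for S
      using that by (simp add: subtopology_Times subtopology_subtopology Int_absorb1)
    show "continuous_map (subtopology ?Z ({0..1} \<times> ?Y)) X h"
      unfolding sub[OF Lsub(2)] using h' by (rule continuous_map_eq) (auto simp: h_def)
    have "continuous_map (prod_topology ?T (subtopology X D)) (prod_topology ?T ?U) (\<lambda>p. (fst p, \<psi> (snd p)))"
      using continuous_map_compose[OF continuous_map_snd \<psi>]
      by (auto simp: continuous_map_paired o_def continuous_map_fst)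
    from continuous_map_compose[OF this conthB]
    show "continuous_map (subtopology ?Z ({0..1} \<times> D)) X h"
      unfolding sub[OF DL] by (rule continuous_map_eq) (auto simp: h_D topD)
  qed
  have conts: "continuous_map (subtopology X (\<Union>L)) (powertop_real UNIV) s"
  proof (rule continuous_map_closed_union)
    show "closedin (subtopology X (\<Union>L)) ?Y" "closedin (subtopology X (\<Union>L)) D"
      using closedin_subcomplex[OF X L'] closedD DL Lsub(2) by (auto intro: closedin_closed_subtopology[THEN iffD2] closedin_subset_topspace)
    show "topspace (subtopology X (\<Union>L)) \<subseteq> ?Y \<union> D" using UL by auto
    have sub: "subtopology (subtopology X (\<Union>L)) S = subtopology X S" if "S \<subseteq> \<Union>L" for S
      using that by (simp add: subtopology_subtopology Int_absorb1)
    show "continuous_map (subtopology (subtopology X (\<Union>L)) ?Y) (powertop_real UNIV) s"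
      unfolding sub[OF Lsub(2)] using s' by (rule continuous_map_eq) (auto simp: s_def)
    from continuous_map_compose[OF \<psi> contsB]
    show "continuous_map (subtopology (subtopology X (\<Union>L)) D) (powertop_real UNIV) s"
      unfolding sub[OF DL] by (rule continuous_map_eq) (auto simp: s_D topD)
  qed
  have h0: "h (0, x) = x" if "x \<in> \<Union>L" for x
  proof (cases "x \<in> ?Y")
    case False
    then have "x \<in> D" using UL that by blast
    then show ?thesis
      using False \<psi>B[of x] \<rho>1[of "\<psi> x"] \<phi>\<psi>[of x] by (auto simp: h_def hB_def)
  qed (simp add: h_def h'0)
  have hM: "h (t, x) \<in> \<Union>M" if M: "subcomplex X K M" and t: "t \<in> {0..1}" and x: "x \<in> \<Union>M" "x \<in> \<Union>L" for M t x
  proof (cases "x \<in> ?Y")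
    case False
    then have "x \<in> e" using x by blast
    moreover obtain c where c: "c \<in> M" "x \<in> c" using x by blast
    ultimately have "c = e" using cells_disjoint[OF X eK, of c x] M by (auto simp: subcomplex_def)
    then have "X closure_of e \<subseteq> \<Union>M" using M c unfolding subcomplex_def by blast
    then have DM: "D \<subseteq> \<Union>M" by (simp add: D_def clos)
    have "x \<in> D" using UL x(2) False by blast
    then have y: "\<psi> x \<in> ?B" by (rule \<psi>B)
    show ?thesis
    proof (cases "(1 + t) * ?\<rho> (\<psi> x) \<le> 1")
      case True
      then have "(\<lambda>i. (1 + t) * \<psi> x i) \<in> ?B" using y t by (auto intro!: scale_in_unit_cell)
      then show ?thesis using False True DM by (auto simp: h_def hB_def D_def)
    next
      case F2: False
      then have "0 < ?\<rho> (\<psi> x)" using radius_nonneg[of ?d "\<psi> x"] by (auto simp: less_le)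
      then have "\<phi> (N (\<psi> x)) \<in> ?Y" "\<phi> (N (\<psi> x)) \<in> \<Union>M"
        using N[OF y] NB[OF y] bdryY DM by (auto simp: D_def)
      moreover have "min t (2 * ((1 + t) * ?\<rho> (\<psi> x) - 1)) \<in> {0..1}" using F2 t by auto
      ultimately have "h' (min t (2 * ((1 + t) * ?\<rho> (\<psi> x) - 1)), \<phi> (N (\<psi> x))) \<in> \<Union>M"
        using h'M[OF M] by blast
      then show ?thesis using False F2 by (simp add: h_def hB_def)
    qed
  qed (use h'M[OF M t x(1)] in \<open>simp add: h_def\<close>)
  have sI: "s x \<in> simplex_face I" if "x \<in> \<Union>L" for x
  proof (cases "x \<in> ?Y")
    case False
    then have "x \<in> D" using UL that by blast
    then have y: "\<psi> x \<in> ?B" by (rule \<psi>B)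
    show ?thesis
    proof (cases "?\<rho> (\<psi> x) \<le> 3/4")
      case True
      then show ?thesis using False vertex_in_simplex_face[OF I] by (simp add: s_def sB_def)
    next
      case F2: False
      then have "0 < ?\<rho> (\<psi> x)" by linarith
      then have "s' (\<phi> (N (\<psi> x))) \<in> simplex_face I" using s'I bdryY N[OF y] by blast
      from simplex_face_convex[OF this vertex_in_simplex_face[OF I], of "4 * ?\<rho> (\<psi> x) - 3"]
      show ?thesis using False F2 \<rho>1[OF y] by (simp add: s_def sB_def)
    qed
  qed (simp add: s_def s'I)
  have new: "vertex_support (s x) \<subseteq> {v} \<or>
      (\<exists>x'. x' \<in> ?Y \<and> x' \<in> \<Union>{e'\<in>K. dm e' < dm e} \<and> h (1, x) = h' (1, x') \<and>
            vertex_support (s x) \<subseteq> insert v (vertex_support (s' x')))" if "x \<in> e" for x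
  proof (cases "?\<rho> (\<psi> x) \<le> 3/4")
    case True
    then show ?thesis using eY[OF that] by (auto simp: s_def sB_def vertex_support_def)
  next
    case False
    have "x \<in> D" using inter that by (auto simp: D_def unit_cell_interior_def)
    then have y: "\<psi> x \<in> ?B" by (rule \<psi>B)
    have "0 < ?\<rho> (\<psi> x)" using False by linarith
    then have NN: "N (\<psi> x) \<in> unit_cell_boundary ?d" by (rule N[OF y])
    have "x \<notin> ?Y" using eY[OF that] .
    then have "h (1, x) = h' (1, \<phi> (N (\<psi> x)))" "s x = sB (\<psi> x)"
      using False by (simp_all add: h_def hB_def s_def min_def)
    moreover from this(2) have "vertex_support (s x) \<subseteq> insert v (vertex_support (s' (\<phi> (N (\<psi> x)))))"
      using False by (auto simp: sB_def vertex_support_def zero_less_mult_iff)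
    moreover have "\<phi> (N (\<psi> x)) \<in> ?Y" "\<phi> (N (\<psi> x)) \<in> \<Union>{e'\<in>K. dm e' < dm e}"
      using bdryY[OF NN] bdry NN by auto
    ultimately show ?thesis by (intro disjI2 exI[of _ "\<phi> (N (\<psi> x))"] conjI)
  qed
  have sA: "h (1, x) \<in> \<Union>(A i)" if x: "x \<in> \<Union>L" and i: "i \<in> vertex_support (s x)" for x i
  proof (cases "x \<in> ?Y")
    case True
    then show ?thesis using s'A[OF True] i by (simp add: h_def s_def)
  next
    case False
    then have xe: "x \<in> e" using x by blast
    show ?thesis
    proof (cases "i = v")
      case True
      have "x \<in> \<Union>(A v)" using v(1) xe by blast
      then show ?thesis using hM[OF v(2) _ _ x, of 1] True by simp
    next
      case False
      with new[OF xe] i obtain x' where "x' \<in> ?Y" "h (1, x) = h' (1, x')" "i \<in> vertex_support (s' x')"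
        by blast
      then show ?thesis using s'A by simp
    qed
  qed
  have scard: "card (vertex_support (s x)) \<le> dm c + 1" if c: "c \<in> L" "x \<in> c" for c x
  proof (cases "c = e")
    case False
    then have "x \<in> ?Y" "c \<in> L - {e}" using c by auto
    then show ?thesis using s'card[of c x] c(2) by (simp add: s_def)
  next
    case True
    consider "vertex_support (s x) \<subseteq> {v}"
      | x' where "x' \<in> ?Y" "x' \<in> \<Union>{e'\<in>K. dm e' < dm e}"
          "vertex_support (s x) \<subseteq> insert v (vertex_support (s' x'))"
      using new[of x] c(2) True by blast
    then show ?thesis
    proof cases
      case 1
      then have "card (vertex_support (s x)) \<le> card {v}" by (intro card_mono) auto
      then show ?thesis by simp
    next
      case 2
      then obtain c1 c2 where c12: "c1 \<in> L - {e}" "x' \<in> c1" "c2 \<in> K" "dm c2 < dm e" "x' \<in> c2" by auto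
      have "c1 \<in> K" using c12(1) L by (auto simp: subcomplex_def)
      then have "c1 = c2" using cells_disjoint[OF X _ c12(3) c12(2,5)] by blast
      then have "card (vertex_support (s' x')) \<le> dm e" using s'card[OF c12(1,2)] c12(4) by simp
      moreover have fin: "finite (vertex_support (s' x'))"
        using vertex_support_simplex_face[OF s'I[OF 2(1)]] I finite_subset by blast
      moreover have "card (vertex_support (s x)) \<le> card (insert v (vertex_support (s' x')))"
        using fin 2(3) by (intro card_mono) auto
      moreover have "card (insert v (vertex_support (s' x'))) \<le> Suc (card (vertex_support (s' x')))"
        using fin by (simp add: card_insert_if)
      ultimately show ?thesis using True by simp
    qed
  qed
  have "labelled_collapse X K dm A I L h s"
    unfolding labelled_collapse_def using conth conts h0 hM sI sA scard by auto
  then show ?thesis by blast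
qed

text \<open>The cells are added in the order of increasing dimension.\<close>

lemma labelled_collapse_exists:
  assumes X: "finite_regular_cell_complex X K dm"
    and L: "subcomplex X K L"
    and labels: "\<And>e. e \<in> L \<Longrightarrow> \<exists>v\<in>I. e \<in> A v \<and> subcomplex X K (A v)" and I: "finite I"
  shows "\<exists>h s. labelled_collapse X K dm A I L h s"
proof -
  have "finite L"
    using L finite_regular_cell_complexD(2)[OF X] finite_subset unfolding subcomplex_def by metis
  then show ?thesis
    using L labels
  proof (induction "card L" arbitrary: L)
    case 0
    then have "L = {}" by simp
    then have "labelled_collapse X K dm A I L snd (\<lambda>x i. 0)"
      by (simp add: labelled_collapse_def continuous_map_componentwise_UNIV continuous_map_on_empty)
    then show ?case by blast
  next
    case (Suc m)
    then have "L \<noteq> {}" by auto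
    then have "Max (dm ` L) \<in> dm ` L" using \<open>finite L\<close> by simp
    then obtain e where "e \<in> L" "dm e = Max (dm ` L)" by auto
    then have e: "e \<in> L" "\<And>e'. e' \<in> L \<Longrightarrow> dm e' \<le> dm e"
      using \<open>finite L\<close> by simp_all
    have L': "subcomplex X K (L - {e})"
      using subcomplex_remove_top_cell[OF X Suc.prems(2) e] .
    have "m = card (L - {e})" using Suc.hyps(2) \<open>finite L\<close> e(1) by simp
    then obtain h' s' where hs': "labelled_collapse X K dm A I (L - {e}) h' s'"
      using Suc.hyps(1)[of "L - {e}"] Suc.prems L' by auto
    obtain v where v: "v \<in> I" "e \<in> A v" "subcomplex X K (A v)" using Suc.prems(3)[OF e(1)] by blast
    show ?case
      by (rule labelled_collapse_extend_over_cell[OF X Suc.prems(2) L' e(1) hs' I v])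
  qed
qed

section \<open>The dimension of the cylinder over a subcomplex\<close>

text \<open>The coordinates of the cylinder over the unit \<open>d\<close>-cell are the time and the \<open>d\<close> coordinates of the
  cell; there are \<open>d + 1\<close> of them.\<close>

lemma zero_avoidable_unit_cell_cylinder:
  assumes "d + 1 < d'"
  shows "zero_avoidable (prod_topology (top_of_set {0..1::real}) (unit_cell d)) d'"
proof -
  let ?B = "topspace (unit_cell d)"
  define c :: "nat \<Rightarrow> real \<times> (nat \<Rightarrow> real) \<Rightarrow> real" where
    "c i z = (case i of 0 \<Rightarrow> fst z | Suc j \<Rightarrow> snd z j)" for i z
  have eq: "prod_topology (top_of_set {0..1::real}) (unit_cell d) = top_of_set ({0..1} \<times> ?B)"
    by (subst unit_cell_eq) (simp add: euclidean_product_topology)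
  have "zero_avoidable (top_of_set ({0..1::real} \<times> ?B)) d'"
  proof (rule zero_avoidable_compact_coordinates[where p = "d + 1" and c = c])
    show "compact ({0..1::real} \<times> ?B)" by (intro compact_Times compact_unit_cell) simp
    show "continuous_on ({0..1} \<times> ?B) (c i)" for i
    proof (cases i)
      case (Suc j)
      have "continuous_on ({0..1::real} \<times> ?B) ((\<lambda>y. y j) \<circ> snd)"
        by (rule continuous_on_compose[OF continuous_on_snd[OF continuous_on_id]
              continuous_on_subset[OF continuous_on_product_coordinates subset_UNIV]])
      then show ?thesis by (simp add: c_def [abs_def] Suc o_def)
    qed (simp add: c_def [abs_def] continuous_on_fst continuous_on_id)
    show "\<bar>c i z\<bar> \<le> 1" if "z \<in> {0..1} \<times> ?B" for i z
      using that unit_cell_coordinate_le[of "snd z" d] by (cases i) (auto simp: c_def)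
    show "\<exists>i<d + 1. c i x \<noteq> c i y" if xy: "x \<in> {0..1} \<times> ?B" "y \<in> {0..1} \<times> ?B" "x \<noteq> y" for x y
    proof (cases "fst x = fst y")
      case True
      then obtain j where j: "snd x j \<noteq> snd y j" using xy(3) by (metis ext prod_eqI)
      have "j < d"
      proof (rule ccontr)
        assume "\<not> j < d"
        then have "snd x j = 0" "snd y j = 0" using xy by (auto simp: topspace_unit_cell)
        then show False using j by simp
      qed
      then show ?thesis using j by (intro exI[of _ "Suc j"]) (simp add: c_def)
    qed (auto simp: c_def intro!: exI[of _ 0])
  qed (use assms in auto)
  then show ?thesis by (simp add: eq)
qed

lemma compactin_subcomplex:
  assumes "finite_regular_cell_complex X K dm" "subcomplex X K L"
  shows "compactin X (\<Union>L)"
proof -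
  have L: "finite L" "L \<subseteq> K"
    using assms finite_subset[OF _ finite_regular_cell_complexD(2)[OF assms(1)]] by (auto simp: subcomplex_def)
  have "compactin X (X closure_of e)" if "e \<in> L" for e
  proof -
    have "e \<in> K" using that L by blast
    from cell_chart[OF assms(1) this] obtain \<phi> where \<phi>: "continuous_map (unit_cell (dm e)) X \<phi>"
      "X closure_of e = \<phi> ` topspace (unit_cell (dm e))" by blast
    then show ?thesis
      using compact_space_unit_cell image_compactin unfolding compact_space_def by metis
  qed
  then have "compactin X (\<Union>e\<in>L. X closure_of e)"
    using L by (intro compactin_Union) auto
  moreover have "\<Union>L = (\<Union>e\<in>L. X closure_of e)"
    using assms cell_subset_closure unfolding subcomplex_def by blast
  ultimately show ?thesis by simp
qed

text \<open>The closed cells of dimension at most \<open>k\<close> give a finite closed cover of the cylinder by pieces of dimension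
  at most \<open>k + 1\<close>.\<close>

lemma zero_avoidable_subcomplex_cylinder:
  assumes X: "finite_regular_cell_complex X K dm" and L: "subcomplex X K L"
    and dim: "\<And>e. e \<in> L \<Longrightarrow> dm e \<le> k" and "k + 1 < d"
  shows "zero_avoidable (prod_topology (top_of_set {0..1::real}) (subtopology X (\<Union>L))) d"
proof -
  let ?I = "top_of_set {0..1::real}"
  let ?Z = "prod_topology ?I (subtopology X (\<Union>L))"
  have fin: "finite L" "L \<subseteq> K"
    using L finite_subset[OF _ finite_regular_cell_complexD(2)[OF X]] by (auto simp: subcomplex_def)
  have sub: "X closure_of e \<subseteq> \<Union>L" if "e \<in> L" for e
    using L that unfolding subcomplex_def by blast
  show ?thesis
  proof (rule zero_avoidable_closed_cover)
    have "compact_space (subtopology X (\<Union>L))"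
      using compactin_subcomplex[OF X L] compact_space_subtopology by blast
    then show "compact_space ?Z"
      by (simp add: compact_space_prod_topology compact_space_subtopology)
    show "Hausdorff_space ?Z"
      using finite_regular_cell_complexD(1)[OF X]
      by (intro Hausdorff_space_prod_topology[THEN iffD2] disjI2 conjI Hausdorff_space_subtopology) auto
    show "finite ((\<lambda>e. {0..1::real} \<times> X closure_of e) ` L)" using fin by simp
    show "topspace ?Z \<subseteq> \<Union>((\<lambda>e. {0..1::real} \<times> X closure_of e) ` L)"
      using cell_subset_closure[OF X] fin(2) by fastforce
  next
    fix C assume "C \<in> (\<lambda>e. {0..1::real} \<times> X closure_of e) ` L"
    then obtain e where e: "e \<in> L" "C = {0..1} \<times> X closure_of e" by blast
    have "closedin (subtopology X (\<Union>L)) (X closure_of e)"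
      using sub[OF e(1)] by (auto intro: closedin_subset_topspace)
    then show "closedin ?Z C" by (simp add: e closedin_prod_Times_iff)
    have "e \<in> K" using e fin by blast
    from cell_chart[OF X this] obtain \<phi> where \<phi>: "embedding_map (unit_cell (dm e)) X \<phi>"
      "X closure_of e = \<phi> ` topspace (unit_cell (dm e))" by blast
    then have "homeomorphic_map (unit_cell (dm e)) (subtopology X (X closure_of e)) \<phi>"
      by (simp add: embedding_map_def)
    then have "unit_cell (dm e) homeomorphic_space subtopology X (X closure_of e)"
      by (rule homeomorphic_map_imp_homeomorphic_space)
    then have "prod_topology ?I (unit_cell (dm e)) homeomorphic_space
        prod_topology ?I (subtopology X (X closure_of e))"
      by (intro homeomorphic_space_prod_topology homeomorphic_space_refl)
    moreover have "zero_avoidable (prod_topology ?I (unit_cell (dm e))) d"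
      using dim[OF e(1)] \<open>k + 1 < d\<close> by (intro zero_avoidable_unit_cell_cylinder) linarith
    ultimately have "zero_avoidable (prod_topology ?I (subtopology X (X closure_of e))) d"
      using zero_avoidable_homeomorphic by blast
    moreover have "subtopology ?Z C = prod_topology ?I (subtopology X (X closure_of e))"
      using sub[OF e(1)] by (simp add: e subtopology_Times subtopology_subtopology Int_absorb1)
    ultimately show "zero_avoidable (subtopology ?Z C) d" by simp
  qed
qed

section \<open>Diagram preserving maps and homotopies\<close>

lemma respects_diagram_cong:
  assumes "\<And>I. I \<in> index_sets n \<Longrightarrow> D I \<subseteq> topspace S" "\<And>x. x \<in> topspace S \<Longrightarrow> f x = g x"
  shows "respects_diagram n D E f \<longleftrightarrow> respects_diagram n D E g"
proof -
  have "f ` D I = g ` D I" if "I \<in> index_sets n" for I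
    using assms that by (intro image_cong) auto
  then show ?thesis by (simp add: respects_diagram_def)
qed

lemma respects_diagram_compose:
  assumes "respects_diagram n D E f" "respects_diagram n E F g"
  shows "respects_diagram n D F (g \<circ> f)"
  using assms by (fastforce simp: respects_diagram_def)

lemma diagram_homotopicI:
  assumes "\<And>I. I \<in> index_sets n \<Longrightarrow> D I \<subseteq> topspace S"
    and "continuous_map (prod_topology (top_of_set {0..1::real}) S) T h"
    and "\<And>x. x \<in> topspace S \<Longrightarrow> h (0, x) = f x" "\<And>x. x \<in> topspace S \<Longrightarrow> h (1, x) = g x"
    and "\<And>I t x. I \<in> index_sets n \<Longrightarrow> t \<in> {0..1} \<Longrightarrow> x \<in> D I \<Longrightarrow> h (t, x) \<in> E I"
  shows "diagram_homotopic n S D T E f g"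
proof -
  have ex: "\<exists>h. continuous_map (prod_topology (top_of_set {0..1::real}) S) T h \<and>
      (\<forall>x\<in>topspace S. h (0, x) = f x) \<and> (\<forall>x\<in>topspace S. h (1, x) = g x) \<and>
      (\<forall>t\<in>{0..1}. respects_diagram n D E (\<lambda>x. h (t, x)))"
  proof (intro exI[of _ h] conjI ballI)
    show "respects_diagram n D E (\<lambda>x. h (t, x))" if "t \<in> {0..1}" for t
      using assms(5) that unfolding respects_diagram_def by blast
  qed (use assms(2-4) in auto)
  show ?thesis
    unfolding diagram_homotopic_def
  proof (subst homotopic_with)
    show "respects_diagram n D E h1 \<longleftrightarrow> respects_diagram n D E h2"
      if "\<And>x. x \<in> topspace S \<Longrightarrow> h1 x = h2 x" for h1 h2
      using assms(1) that by (rule respects_diagram_cong)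
  qed (rule ex)
qed

lemma diagram_homotopic_compose_left:
  assumes "diagram_homotopic n S D T E f g" "diagram_preserving n T E U F k"
  shows "diagram_homotopic n S D U F (k \<circ> f) (k \<circ> g)"
  using assms unfolding diagram_homotopic_def diagram_preserving_def
  by (blast intro: homotopic_with_compose_continuous_map_left respects_diagram_compose)

lemma diagram_homotopic_compose_right:
  assumes "diagram_homotopic n S D T E f g" "diagram_preserving n U F S D k"
  shows "diagram_homotopic n U F T E (f \<circ> k) (g \<circ> k)"
  using assms unfolding diagram_homotopic_def diagram_preserving_def
  by (blast intro: homotopic_with_compose_continuous_map_right respects_diagram_compose)

lemma diagram_homotopic_trans:
  assumes "diagram_homotopic n S D T E f g" "diagram_homotopic n S D T E g k"
  shows "diagram_homotopic n S D T E f k"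
  using assms unfolding diagram_homotopic_def by (rule homotopic_with_trans)

lemma diagram_homotopic_sym:
  "diagram_homotopic n S D T E f g \<Longrightarrow> diagram_homotopic n S D T E g f"
  unfolding diagram_homotopic_def by (rule homotopic_with_symD)

lemma diagram_preserving_compose:
  assumes "diagram_preserving n S D T E f" "diagram_preserving n T E U F g"
  shows "diagram_preserving n S D U F (g \<circ> f)"
  using assms unfolding diagram_preserving_def
  by (blast intro: continuous_map_compose respects_diagram_compose)

section \<open>Families of subcomplexes and their homotopy co-limits\<close>

definition collapse_section ::
    "(real \<times> 'a \<Rightarrow> 'a) \<Rightarrow> ('a \<Rightarrow> nat \<Rightarrow> real) \<Rightarrow> 'a \<Rightarrow> (nat \<Rightarrow> real) \<times> 'a" where
  "collapse_section h s x = (s x, h (1, x))"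

locale cell_family =
  fixes X :: "'a topology" and K :: "'a set set" and dm :: "'a set \<Rightarrow> nat"
    and A :: "nat \<Rightarrow> 'a set set" and n :: nat
  assumes complex: "finite_regular_cell_complex X K dm"
    and family: "\<And>i. i \<in> {1..n} \<Longrightarrow> subcomplex X K (A i)"
begin

abbreviation cells :: "'a set set" where "cells \<equiv> \<Union>(A ` {1..n})"

abbreviation member :: "nat \<Rightarrow> 'a set" where "member i \<equiv> \<Union>(A i)"

lemma family_subset: "i \<in> {1..n} \<Longrightarrow> A i \<subseteq> K"
  using family unfolding subcomplex_def by blast

lemma subcomplex_cells: "subcomplex X K cells"
  unfolding subcomplex_def
proof (intro conjI ballI)
  show "cells \<subseteq> K" using family_subset by blast
  fix e assume "e \<in> cells"
  then obtain i where "i \<in> {1..n}" "e \<in> A i" by blast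
  then show "X closure_of e \<subseteq> \<Union>cells" using family[of i] unfolding subcomplex_def by blast
qed

lemma union_space_eq: "union_space X A n = subtopology X (\<Union>cells)"
  by (simp add: union_space_def union_carrier_def)

lemma cells_subset_topspace: "\<Union>cells \<subseteq> topspace X"
  using closedin_subset[OF closedin_subcomplex[OF complex subcomplex_cells]] .

lemma topspace_union_space: "topspace (union_space X A n) = \<Union>cells"
  using cells_subset_topspace by (auto simp: union_space_eq)

lemma member_subset: "i \<in> {1..n} \<Longrightarrow> member i \<subseteq> \<Union>cells"
  by blast

text \<open>A point lies in only one cell; if it belongs to the spaces of several \<open>A i\<close>, that cell is common to
  them.\<close>

lemma inter_carrier_iff:
  assumes "I \<in> index_sets n"
  shows "x \<in> inter_carrier A I \<longleftrightarrow> (\<forall>i\<in>I. x \<in> member i)"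
proof
  assume r: "\<forall>i\<in>I. x \<in> member i"
  obtain i0 where i0: "i0 \<in> I" using assms by (auto simp: index_sets_def)
  then obtain e where e: "e \<in> A i0" "x \<in> e" using r by blast
  have AK: "A i \<subseteq> K" if "i \<in> I" for i
    using family_subset[of i] assms that unfolding index_sets_def by blast
  have "e \<in> A i" if i: "i \<in> I" for i
  proof -
    obtain e' where e': "e' \<in> A i" "x \<in> e'" using r i by blast
    then have "e' = e" using cells_disjoint[OF complex _ _ e'(2) e(2)] AK i i0 e(1) by blast
    then show ?thesis using e' by simp
  qed
  then show "x \<in> inter_carrier A I" using e by (auto simp: inter_carrier_def)
qed (auto simp: inter_carrier_def)

lemma inter_carrier_subset: "I \<in> index_sets n \<Longrightarrow> inter_carrier A I \<subseteq> topspace (union_space X A n)"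
  unfolding topspace_union_space by (auto simp: inter_carrier_def index_sets_def)

lemma simplex_face_support:
  assumes "s \<in> simplex_face {1..n}"
  shows "vertex_support s \<in> index_sets n" "s \<in> simplex_face (vertex_support s)"
proof -
  have sub: "vertex_support s \<subseteq> {1..n}" using assms by (rule vertex_support_simplex_face)
  have zero: "s i = 0" if "i \<notin> vertex_support s" for i
    using assms that by (auto simp: simplex_face_def vertex_support_def less_le)
  have "sum s (vertex_support s) = sum s {1..n}"
    using sub zero by (intro sum.mono_neutral_left) auto
  then show "s \<in> simplex_face (vertex_support s)"
    using assms zero by (auto simp: simplex_face_def)
  then have "vertex_support s \<noteq> {}" by (auto simp: simplex_face_def)
  then show "vertex_support s \<in> index_sets n" using sub by (simp add: index_sets_def)
qed

text \<open>In terms of the support of the barycentric coordinates, the truncated co-limit is described without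
  reference to the faces that cover it, and continuous maps into it can be built by controlling
  supports.\<close>

lemma hocolim_trunc_carrier_iff:
  "p \<in> hocolim_trunc_carrier m n A \<longleftrightarrow>
     fst p \<in> simplex_face {1..n} \<and> card (vertex_support (fst p)) \<le> m + 1 \<and>
     (\<forall>i\<in>vertex_support (fst p). snd p \<in> member i)"
proof
  assume "p \<in> hocolim_trunc_carrier m n A"
  then obtain I J where I: "I \<in> index_sets n" "fst p \<in> simplex_face I" "snd p \<in> inter_carrier A I"
    and J: "J \<in> index_sets n" "card J \<le> m + 1" "fst p \<in> simplex_face J"
    by (auto simp: hocolim_trunc_carrier_def hocolim_carrier_def simplex_skeleton_def)
  have "finite J" using J(1) finite_subset by (auto simp: index_sets_def)
  then have "card (vertex_support (fst p)) \<le> card J"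
    using vertex_support_simplex_face[OF J(3)] card_mono by blast
  moreover have "fst p \<in> simplex_face {1..n}"
    using simplex_face_mono[OF _ _ I(2)] I(1) by (simp add: index_sets_def)
  moreover have "\<forall>i\<in>vertex_support (fst p). snd p \<in> member i"
    using inter_carrier_iff[OF I(1)] I(3) vertex_support_simplex_face[OF I(2)] by blast
  ultimately show "fst p \<in> simplex_face {1..n} \<and> card (vertex_support (fst p)) \<le> m + 1 \<and>
     (\<forall>i\<in>vertex_support (fst p). snd p \<in> member i)" using J(2) by linarith
next
  assume r: "fst p \<in> simplex_face {1..n} \<and> card (vertex_support (fst p)) \<le> m + 1 \<and>
     (\<forall>i\<in>vertex_support (fst p). snd p \<in> member i)"
  let ?I = "vertex_support (fst p)"
  have I: "?I \<in> index_sets n" "fst p \<in> simplex_face ?I" using simplex_face_support[of "fst p"] r by auto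
  moreover have "snd p \<in> inter_carrier A ?I" using inter_carrier_iff[OF I(1)] r by blast
  ultimately have "p \<in> hocolim_carrier n A"
    unfolding hocolim_carrier_def by (auto simp: mem_Times_iff)
  moreover have "fst p \<in> simplex_skeleton m n"
    using I r unfolding simplex_skeleton_def by blast
  ultimately show "p \<in> hocolim_trunc_carrier m n A" by (simp add: hocolim_trunc_carrier_def)
qed

lemma hocolim_trunc_carrier_snd:
  assumes "p \<in> hocolim_trunc_carrier m n A"
  shows "snd p \<in> \<Union>cells"
proof -
  have r: "fst p \<in> simplex_face {1..n}" "\<forall>i\<in>vertex_support (fst p). snd p \<in> member i"
    using assms by (simp_all add: hocolim_trunc_carrier_iff)
  then have "vertex_support (fst p) \<in> index_sets n" using simplex_face_support by blast
  then show ?thesis using r(2) by (auto simp: index_sets_def)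
qed

lemma topspace_hocolim_trunc: "topspace (hocolim_trunc X m n A) = hocolim_trunc_carrier m n A"
  using hocolim_trunc_carrier_snd topspace_union_space hocolim_trunc_carrier_iff
  by (auto simp: hocolim_trunc_def)

lemma continuous_map_into_hocolim_trunc:
  assumes "continuous_map T (powertop_real UNIV) (\<lambda>x. fst (f x))" "continuous_map T X (\<lambda>x. snd (f x))"
    and "\<And>x. x \<in> topspace T \<Longrightarrow> f x \<in> hocolim_trunc_carrier m n A"
  shows "continuous_map T (hocolim_trunc X m n A) f"
  unfolding hocolim_trunc_def
proof (intro continuous_map_into_subtopology)
  show "continuous_map T (prod_topology (subtopology (powertop_real UNIV) (simplex_face {1..n})) (union_space X A n)) f"
    unfolding continuous_map_pairwise o_def union_space_eq
  proof (intro conjI continuous_map_into_subtopology assms(1,2))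
    show "(\<lambda>x. fst (f x)) \<in> topspace T \<rightarrow> simplex_face {1..n}"
      using assms(3) by (simp add: Pi_iff hocolim_trunc_carrier_iff)
    show "(\<lambda>x. snd (f x)) \<in> topspace T \<rightarrow> \<Union>cells"
      using hocolim_trunc_carrier_snd[OF assms(3)] by blast
  qed
qed (use assms in auto)

lemma continuous_map_hocolim_trunc_fst: "continuous_map (hocolim_trunc X m n A) (powertop_real UNIV) fst"
  unfolding hocolim_trunc_def
  by (rule continuous_map_into_fulltopology[OF continuous_map_subtopology_fst])

lemma continuous_map_hocolim_trunc_snd: "continuous_map (hocolim_trunc X m n A) (union_space X A n) snd"
  unfolding hocolim_trunc_def by (rule continuous_map_subtopology_snd)

lemma diagram_preserving_snd:
  "diagram_preserving n (hocolim_trunc X m n A) (hocolim_trunc_inter m n A)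
     (union_space X A n) (inter_carrier A) snd"
  using continuous_map_hocolim_trunc_snd
  by (auto simp: diagram_preserving_def respects_diagram_def hocolim_trunc_inter_def)

context
  fixes h :: "real \<times> 'a \<Rightarrow> 'a" and s :: "'a \<Rightarrow> nat \<Rightarrow> real" and k m :: nat
  assumes collapse: "labelled_collapse X K dm A {1..n} cells h s"
    and dim: "\<And>e. e \<in> cells \<Longrightarrow> dm e \<le> k" and km: "k \<le> m"
begin

lemma collapse_member:
  assumes "i \<in> {1..n}" "t \<in> {0..1}" "x \<in> member i"
  shows "h (t, x) \<in> member i"
  using labelled_collapseD(4)[OF collapse family[OF assms(1)] assms(2,3)] member_subset assms by blast

lemma collapse_inter_carrier:
  assumes "I \<in> index_sets n" "t \<in> {0..1}" "x \<in> inter_carrier A I"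
  shows "h (t, x) \<in> inter_carrier A I"
  using assms collapse_member by (auto simp: inter_carrier_iff[OF assms(1)] index_sets_def subset_iff)

lemma collapse_card: "x \<in> \<Union>cells \<Longrightarrow> card (vertex_support (s x)) \<le> m + 1"
  using labelled_collapseD(7)[OF collapse] dim km by (meson UnionE add_le_mono1 le_trans)

lemma continuous_map_collapse_at:
  "t \<in> {0..1} \<Longrightarrow> continuous_map (union_space X A n) X (\<lambda>x. h (t, x))"
  using continuous_map_compose[OF _ labelled_collapseD(1)[OF collapse], of _ "\<lambda>x. (t, x)"]
  by (simp add: union_space_eq o_def continuous_map_paired)

lemma collapse_section_carrier:
  assumes "x \<in> \<Union>cells"
  shows "collapse_section h s x \<in> hocolim_trunc_carrier m n A"
  using labelled_collapseD(5,6)[OF collapse assms] collapse_card[OF assms]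
  by (simp add: hocolim_trunc_carrier_iff collapse_section_def)

lemma diagram_preserving_collapse_section:
  "diagram_preserving n (union_space X A n) (inter_carrier A)
     (hocolim_trunc X m n A) (hocolim_trunc_inter m n A) (collapse_section h s)"
  unfolding diagram_preserving_def
proof
  show "continuous_map (union_space X A n) (hocolim_trunc X m n A) (collapse_section h s)"
    using continuous_map_collapse_at[of 1] labelled_collapseD(2)[OF collapse] collapse_section_carrier topspace_union_space
    by (intro continuous_map_into_hocolim_trunc) (auto simp: collapse_section_def union_space_eq)
  show "respects_diagram n (inter_carrier A) (hocolim_trunc_inter m n A) (collapse_section h s)"
    unfolding respects_diagram_def
  proof (intro ballI image_subsetI)
    fix I x assume I: "I \<in> index_sets n" and x: "x \<in> inter_carrier A I"
    then have "x \<in> \<Union>cells" using inter_carrier_subset topspace_union_space by blast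
    then have "collapse_section h s x \<in> hocolim_trunc_carrier m n A"
      by (rule collapse_section_carrier)
    moreover have "snd (collapse_section h s x) \<in> inter_carrier A I"
      using collapse_inter_carrier[OF I _ x, of 1] by (simp add: collapse_section_def)
    ultimately show "collapse_section h s x \<in> hocolim_trunc_inter m n A I"
      by (simp add: hocolim_trunc_inter_def)
  qed
qed

lemma snd_collapse_section_homotopic:
  "diagram_homotopic n (union_space X A n) (inter_carrier A) (union_space X A n) (inter_carrier A)
     (snd \<circ> collapse_section h s) id"
proof (rule diagram_homotopic_sym, rule diagram_homotopicI[where h = h])
  show "continuous_map (prod_topology (top_of_set {0..1}) (union_space X A n)) (union_space X A n) h"
    unfolding union_space_eq
  proof (rule continuous_map_into_subtopology[OF labelled_collapseD(1)[OF collapse]])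
    show "h \<in> topspace (prod_topology (top_of_set {0..1}) (subtopology X (\<Union>cells))) \<rightarrow> \<Union>cells"
    proof
      fix z assume "z \<in> topspace (prod_topology (top_of_set {0..1::real}) (subtopology X (\<Union>cells)))"
      then have "fst z \<in> {0..1} \<and> snd z \<in> \<Union>cells"
        by (simp only: topspace_prod_topology topspace_subtopology topspace_euclidean mem_Times_iff Int_iff)
      then show "h z \<in> \<Union>cells"
        using labelled_collapseD(4)[OF collapse subcomplex_cells, of "fst z" "snd z"]
        by (simp only: prod.collapse)
    qed
  qed
qed (use inter_carrier_subset topspace_union_space labelled_collapseD(3)[OF collapse] collapse_inter_carrier
      in \<open>auto simp: collapse_section_def\<close>)

text \<open>The first half of the homotopy collapses the second component and keeps the barycentric coordinates,
  which is possible because the collapse preserves every \<open>A i\<close>.  The second half fixes the collapsed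
  point and moves between two families of barycentric coordinates, both supported in the simplex
  of that point; the straight-line homotopy leaves the \<open>m\<close>-skeleton and is pushed back into it.\<close>

lemma homotopic_collapse_section_snd:
  assumes cylinder: "\<And>d. m < d \<Longrightarrow> zero_avoidable (prod_topology (top_of_set {0..1::real}) T) d"
    and D: "\<And>I. I \<in> index_sets n \<Longrightarrow> D I \<subseteq> topspace T"
    and w: "diagram_preserving n T D (hocolim_trunc X m n A) (hocolim_trunc_inter m n A) w"
  shows "diagram_homotopic n T D (hocolim_trunc X m n A) (hocolim_trunc_inter m n A)
           w (collapse_section h s \<circ> snd \<circ> w)"
proof -
  let ?I = "top_of_set {0..1::real}"
  let ?T = "prod_topology ?I T"
  define p where "p x = fst (w x)" for x
  define q where "q x = snd (w x)" for x
  have wc: "continuous_map T (hocolim_trunc X m n A) w" using w by (simp add: diagram_preserving_def)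
  have wcar: "w x \<in> hocolim_trunc_carrier m n A" if "x \<in> topspace T" for x
    using continuous_map_image_subset_topspace[OF wc] that topspace_hocolim_trunc by blast
  have p: "p x \<in> simplex_face {1..n}" "card (vertex_support (p x)) \<le> m + 1"
      "\<And>i. i \<in> vertex_support (p x) \<Longrightarrow> i \<in> {1..n} \<and> q x \<in> member i" if "x \<in> topspace T" for x
  proof -
    show 1: "p x \<in> simplex_face {1..n}" "card (vertex_support (p x)) \<le> m + 1"
      using wcar[OF that] by (simp_all add: hocolim_trunc_carrier_iff p_def)
    show "i \<in> {1..n} \<and> q x \<in> member i" if "i \<in> vertex_support (p x)" for i
      using wcar[OF \<open>x \<in> topspace T\<close>] vertex_support_simplex_face[OF 1(1)] that
      unfolding hocolim_trunc_carrier_iff p_def q_def by blast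
  qed
  have q: "q x \<in> \<Union>cells" if "x \<in> topspace T" for x
    using hocolim_trunc_carrier_snd[OF wcar[OF that]] by (simp add: q_def)
  have qD: "q x \<in> inter_carrier A I" if "I \<in> index_sets n" "x \<in> D I" for I x
  proof -
    have "w x \<in> hocolim_trunc_inter m n A I"
      using w that by (auto simp: diagram_preserving_def respects_diagram_def)
    then show ?thesis by (simp add: hocolim_trunc_inter_def q_def)
  qed
  have pc: "continuous_map T (powertop_real UNIV) p"
    using continuous_map_compose[OF wc continuous_map_hocolim_trunc_fst] by (simp add: p_def [abs_def] o_def)
  have qc: "continuous_map T (subtopology X (\<Union>cells)) q"
    using continuous_map_compose[OF wc continuous_map_hocolim_trunc_snd] by (simp add: q_def [abs_def] o_def union_space_eq)
  have sndc: "continuous_map ?T T snd" by (rule continuous_map_snd)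
  have qc': "continuous_map ?T (subtopology X (\<Union>cells)) (\<lambda>z. q (snd z))"
    using continuous_map_compose[OF sndc qc] by (simp add: o_def)
  have pc': "continuous_map ?T (powertop_real UNIV) (\<lambda>z. p (snd z))"
    using continuous_map_compose[OF sndc pc] by (simp add: o_def)
  have fstc: "continuous_map ?T ?I fst" by (rule continuous_map_fst)
  have fstr: "continuous_map ?T euclideanreal fst" using fstc continuous_map_into_fulltopology by blast
  have hq: "continuous_map ?T X (\<lambda>z. h (fst z, q (snd z)))"
    using continuous_map_compose[OF continuous_map_pairedI[OF fstc qc'] labelled_collapseD(1)[OF collapse]]
    by (simp add: o_def)
  have one: "continuous_map ?T ?I (\<lambda>z. 1)" by simp
  have hq1: "continuous_map ?T X (\<lambda>z. h (1, q (snd z)))"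
    using continuous_map_compose[OF continuous_map_pairedI[OF one qc'] labelled_collapseD(1)[OF collapse]]
    by (simp add: o_def)
  have sq: "continuous_map ?T (powertop_real UNIV) (\<lambda>z. s (q (snd z)))"
    using continuous_map_compose[OF qc' labelled_collapseD(2)[OF collapse]] by (simp add: o_def)
  have first: "diagram_homotopic n T D (hocolim_trunc X m n A) (hocolim_trunc_inter m n A) w (\<lambda>x. (p x, h (1, q x)))"
  proof (rule diagram_homotopicI[OF D, where h = "\<lambda>z. (p (snd z), h (fst z, q (snd z)))"])
    have car: "(p x, h (t, q x)) \<in> hocolim_trunc_carrier m n A" if "t \<in> {0..1}" "x \<in> topspace T" for t :: real and x
      using p[OF that(2)] collapse_member[OF _ that(1)] by (auto simp: hocolim_trunc_carrier_iff)
    then show "continuous_map ?T (hocolim_trunc X m n A) (\<lambda>z. (p (snd z), h (fst z, q (snd z))))"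
      using pc' hq by (intro continuous_map_into_hocolim_trunc) auto
    fix I x and t :: real assume I: "I \<in> index_sets n" "t \<in> {0..1}" "x \<in> D I"
    then have "(p x, h (t, q x)) \<in> hocolim_trunc_carrier m n A" using car D by blast
    moreover have "h (t, q x) \<in> inter_carrier A I" using collapse_inter_carrier[OF I(1,2) qD[OF I(1,3)]] .
    ultimately show "(p (snd (t, x)), h (fst (t, x), q (snd (t, x)))) \<in> hocolim_trunc_inter m n A I"
      by (simp add: hocolim_trunc_inter_def)
  next
    fix x assume "x \<in> topspace T"
    then show "(p (snd (0, x)), h (fst (0, x), q (snd (0, x)))) = w x"
      using labelled_collapseD(3)[OF collapse q] by (simp add: p_def q_def)
  qed auto
  define H where "H z = (\<lambda>i. (1 - fst z) * p (snd z) i + (1 - (1 - fst z)) * s (q (snd z)) i)" for z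
  have Hc: "continuous_map ?T (powertop_real UNIV) H"
    unfolding H_def continuous_map_componentwise_UNIV
  proof
    fix i
    have "continuous_map ?T euclideanreal (\<lambda>z. p (snd z) i)" "continuous_map ?T euclideanreal (\<lambda>z. s (q (snd z)) i)"
      using pc' sq by (simp_all add: continuous_map_componentwise_UNIV)
    then show "continuous_map ?T euclideanreal (\<lambda>z. (1 - fst z) * p (snd z) i + (1 - (1 - fst z)) * s (q (snd z)) i)"
      using fstr by (intro continuous_map_add continuous_map_real_mult continuous_map_diff) auto
  qed
  have HI: "H z \<in> simplex_face {1..n}" if "z \<in> topspace ?T" for z
    unfolding H_def using that p labelled_collapseD(5)[OF collapse q]
    by (intro simplex_face_convex) auto
  have Hsupp: "vertex_support (H z) \<subseteq> vertex_support (p (snd z)) \<union> vertex_support (s (q (snd z)))"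
    if z: "z \<in> topspace ?T" for z
  proof
    fix i assume i: "i \<in> vertex_support (H z)"
    show "i \<in> vertex_support (p (snd z)) \<union> vertex_support (s (q (snd z)))"
    proof (rule ccontr)
      assume "\<not> ?thesis"
      then have "p (snd z) i \<le> 0" "s (q (snd z)) i \<le> 0" by (auto simp: vertex_support_def)
      then have "H z i \<le> 0"
        unfolding H_def using z by (intro add_nonpos_nonpos mult_nonneg_nonpos) auto
      then show False using i by (simp add: vertex_support_def)
    qed
  qed
  have "\<exists>H'. continuous_map ?T (powertop_real UNIV) H' \<and>
      (\<forall>z\<in>topspace ?T. H' z \<in> simplex_face {1..n} \<and> vertex_support (H' z) \<subseteq> vertex_support (H z) \<and>
        card (vertex_support (H' z)) \<le> m + 1 \<and> (card (vertex_support (H z)) \<le> m + 1 \<longrightarrow> H' z = H z))"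
    by (rule push_into_skeleton[OF cylinder _ Hc HI]) simp_all
  then obtain H' where H'c: "continuous_map ?T (powertop_real UNIV) H'"
    and H': "\<forall>z\<in>topspace ?T. H' z \<in> simplex_face {1..n} \<and> vertex_support (H' z) \<subseteq> vertex_support (H z) \<and>
        card (vertex_support (H' z)) \<le> m + 1 \<and> (card (vertex_support (H z)) \<le> m + 1 \<longrightarrow> H' z = H z)"
    by blast
  have second: "diagram_homotopic n T D (hocolim_trunc X m n A) (hocolim_trunc_inter m n A)
      (\<lambda>x. (p x, h (1, q x))) (collapse_section h s \<circ> snd \<circ> w)"
  proof (rule diagram_homotopicI[OF D, where h = "\<lambda>z. (H' z, h (1, q (snd z)))"])
    have car: "(H' z, h (1, q (snd z))) \<in> hocolim_trunc_carrier m n A" if z: "z \<in> topspace ?T" for z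
    proof -
      have x: "snd z \<in> topspace T" using z by auto
      have "h (1, q (snd z)) \<in> member i" if "i \<in> vertex_support (H' z)" for i
      proof -
        have "i \<in> vertex_support (p (snd z)) \<or> i \<in> vertex_support (s (q (snd z)))"
          using that H' Hsupp[OF z] z by blast
        then show ?thesis
          using p(3)[OF x] collapse_member[of i 1 "q (snd z)"] labelled_collapseD(6)[OF collapse q[OF x]] by auto
      qed
      then show ?thesis using bspec[OF H' z] by (simp add: hocolim_trunc_carrier_iff)
    qed
    then show "continuous_map ?T (hocolim_trunc X m n A) (\<lambda>z. (H' z, h (1, q (snd z))))"
      using H'c hq1 by (intro continuous_map_into_hocolim_trunc) auto
    fix I x and t :: real assume I: "I \<in> index_sets n" "t \<in> {0..1}" "x \<in> D I"
    then have "(t, x) \<in> topspace ?T" using D by auto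
    then have "(H' (t, x), h (1, q x)) \<in> hocolim_trunc_carrier m n A" using car by fastforce
    moreover have "h (1, q x) \<in> inter_carrier A I" using collapse_inter_carrier[OF I(1) _ qD[OF I(1,3)], of 1] by simp
    ultimately show "(H' (t, x), h (1, q (snd (t, x)))) \<in> hocolim_trunc_inter m n A I"
      by (simp add: hocolim_trunc_inter_def)
  next
    fix x assume x: "x \<in> topspace T"
    have "H (0, x) = p x" by (simp add: H_def)
    then have "H' (0, x) = p x" using bspec[OF H', of "(0, x)"] p(2)[OF x] x by simp
    then show "(H' (0, x), h (1, q (snd (0, x)))) = (p x, h (1, q x))" by simp
    have "H (1, x) = s (q x)" by (simp add: H_def)
    then have "H' (1, x) = s (q x)" using bspec[OF H', of "(1, x)"] collapse_card[OF q[OF x]] x by simp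
    then show "(H' (1, x), h (1, q (snd (1, x)))) = (collapse_section h s \<circ> snd \<circ> w) x"
      by (simp add: collapse_section_def q_def)
  qed
  show ?thesis using first second by (rule diagram_homotopic_trans)
qed

end

end

text \<open>In the middle of the composite, \<open>collapse_section h' s' \<circ> snd\<close> may be cancelled, because it is applied
  to a map whose source is the low-dimensional union of the family \<open>A\<close>; this brings \<open>\<psi>\<close> and
  \<open>\<phi>\<close> together.\<close>

lemma composite_through_hocolim_homotopic:
  assumes A: "cell_family X K dm A n" and B: "cell_family X K dm B n"
    and hA: "labelled_collapse X K dm A {1..n} (\<Union>(A ` {1..n})) h s"
    and hB: "labelled_collapse X K dm B {1..n} (\<Union>(B ` {1..n})) h' s'"
    and dimA: "\<And>e. e \<in> \<Union>(A ` {1..n}) \<Longrightarrow> dm e \<le> k" and dimB: "\<And>e. e \<in> \<Union>(B ` {1..n}) \<Longrightarrow> dm e \<le> k"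
    and m: "k < m"
    and \<phi>: "diagram_preserving n (hocolim_trunc X m n A) (hocolim_trunc_inter m n A)
          (hocolim_trunc X m n B) (hocolim_trunc_inter m n B) \<phi>"
    and \<psi>: "diagram_preserving n (hocolim_trunc X m n B) (hocolim_trunc_inter m n B)
          (hocolim_trunc X m n A) (hocolim_trunc_inter m n A) \<psi>"
    and \<psi>\<phi>: "diagram_homotopic n (hocolim_trunc X m n A) (hocolim_trunc_inter m n A)
          (hocolim_trunc X m n A) (hocolim_trunc_inter m n A) (\<psi> \<circ> \<phi>) id"
  shows "diagram_homotopic n (union_space X A n) (inter_carrier A) (union_space X A n) (inter_carrier A)
     ((snd \<circ> \<psi> \<circ> collapse_section h' s') \<circ> (snd \<circ> \<phi> \<circ> collapse_section h s)) id"
proof -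
  interpret A: cell_family X K dm A n by fact
  interpret B: cell_family X K dm B n by fact
  have "k \<le> m" using m by simp
  let ?\<sigma> = "collapse_section h s" and ?\<sigma>' = "collapse_section h' s'"
  let ?hom = "diagram_homotopic n (union_space X A n) (inter_carrier A) (union_space X A n) (inter_carrier A)"
  note \<sigma> = A.diagram_preserving_collapse_section[OF hA dimA \<open>k \<le> m\<close>]
  have "zero_avoidable (prod_topology (top_of_set {0..1::real}) (union_space X A n)) d" if "m < d" for d
    unfolding A.union_space_eq
    using zero_avoidable_subcomplex_cylinder[OF A.complex A.subcomplex_cells dimA] m that by simp
  from B.homotopic_collapse_section_snd[OF hB dimB \<open>k \<le> m\<close> this A.inter_carrier_subset
      diagram_preserving_compose[OF \<sigma> \<phi>]]
  have "diagram_homotopic n (union_space X A n) (inter_carrier A) (hocolim_trunc X m n B) (hocolim_trunc_inter m n B)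
      (\<phi> \<circ> ?\<sigma>) (?\<sigma>' \<circ> snd \<circ> (\<phi> \<circ> ?\<sigma>))" .
  from diagram_homotopic_sym[OF diagram_homotopic_compose_left[OF this diagram_preserving_compose[OF \<psi> A.diagram_preserving_snd]]]
  have 1: "?hom ((snd \<circ> \<psi> \<circ> ?\<sigma>') \<circ> (snd \<circ> \<phi> \<circ> ?\<sigma>)) (snd \<circ> (\<psi> \<circ> \<phi>) \<circ> ?\<sigma>)"
    by (simp add: o_assoc)
  from diagram_homotopic_compose_right[OF diagram_homotopic_compose_left[OF \<psi>\<phi> A.diagram_preserving_snd] \<sigma>]
  have 2: "?hom (snd \<circ> (\<psi> \<circ> \<phi>) \<circ> ?\<sigma>) (snd \<circ> ?\<sigma>)" by simp
  have 3: "?hom (snd \<circ> ?\<sigma>) id"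
    by (rule A.snd_collapse_section_homotopic[OF hA dimA \<open>k \<le> m\<close>])
  show ?thesis by (rule diagram_homotopic_trans[OF 1 diagram_homotopic_trans[OF 2 3]])
qed

lemma dim_le_if_complex_dim_le:
  assumes "finite L" "complex_dim dm L \<le> int k" "e \<in> L"
  shows "dm e \<le> k"
proof -
  have "dm e \<le> Max (dm ` L)" using assms by simp
  moreover have "int (Max (dm ` L)) \<le> int k" using assms by (auto simp: complex_dim_def split: if_splits)
  ultimately show ?thesis by linarith
qed

theorem theorem3p7:
  fixes X :: "'a topology" and K :: "'a set set" and dm :: "'a set \<Rightarrow> nat"
    and A B :: "nat \<Rightarrow> 'a set set" and k n :: nat
  assumes "finite_regular_cell_complex X K dm"
    and "\<And>i. i \<in> {1..n} \<Longrightarrow> subcomplex X K (A i)"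
    and "\<And>i. i \<in> {1..n} \<Longrightarrow> subcomplex X K (B i)"
    and "\<And>i. i \<in> {1..n} \<Longrightarrow> complex_dim dm (A i) \<le> int k"
    and "\<And>i. i \<in> {1..n} \<Longrightarrow> complex_dim dm (B i) \<le> int k"
    and "hocolim_equivalent X (k + 2) n A B"
  shows "family_homotopy_equivalent X n A B"
proof -
  have A: "cell_family X K dm A n" and B: "cell_family X K dm B n"
    using assms by (auto intro: cell_family.intro)
  interpret A: cell_family X K dm A n by (rule A)
  interpret B: cell_family X K dm B n by (rule B)
  have fin: "finite L" if "subcomplex X K L" for L
    using that finite_subset[OF _ finite_regular_cell_complexD(2)[OF assms(1)]] by (auto simp: subcomplex_def)
  have dimA: "dm e \<le> k" if "e \<in> \<Union>(A ` {1..n})" for e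
    using that dim_le_if_complex_dim_le[OF fin[OF assms(2)] assms(4)] by auto
  have dimB: "dm e \<le> k" if "e \<in> \<Union>(B ` {1..n})" for e
    using that dim_le_if_complex_dim_le[OF fin[OF assms(3)] assms(5)] by auto
  have "\<exists>h s. labelled_collapse X K dm A {1..n} (\<Union>(A ` {1..n})) h s"
    using assms(2) by (intro labelled_collapse_exists[OF assms(1) A.subcomplex_cells]) auto
  then obtain h s where hA: "labelled_collapse X K dm A {1..n} (\<Union>(A ` {1..n})) h s" by blast
  have "\<exists>h s. labelled_collapse X K dm B {1..n} (\<Union>(B ` {1..n})) h s"
    using assms(3) by (intro labelled_collapse_exists[OF assms(1) B.subcomplex_cells]) auto
  then obtain h' s' where hB: "labelled_collapse X K dm B {1..n} (\<Union>(B ` {1..n})) h' s'" by blast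
  let ?m = "k + 2"
  obtain \<phi> \<psi> where \<phi>: "diagram_preserving n (hocolim_trunc X ?m n A) (hocolim_trunc_inter ?m n A)
          (hocolim_trunc X ?m n B) (hocolim_trunc_inter ?m n B) \<phi>"
    and \<psi>: "diagram_preserving n (hocolim_trunc X ?m n B) (hocolim_trunc_inter ?m n B)
          (hocolim_trunc X ?m n A) (hocolim_trunc_inter ?m n A) \<psi>"
    and \<psi>\<phi>: "diagram_homotopic n (hocolim_trunc X ?m n A) (hocolim_trunc_inter ?m n A)
          (hocolim_trunc X ?m n A) (hocolim_trunc_inter ?m n A) (\<psi> \<circ> \<phi>) id"
    and \<phi>\<psi>: "diagram_homotopic n (hocolim_trunc X ?m n B) (hocolim_trunc_inter ?m n B)
          (hocolim_trunc X ?m n B) (hocolim_trunc_inter ?m n B) (\<phi> \<circ> \<psi>) id"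
    using assms(6) unfolding hocolim_equivalent_def diagram_homotopy_equivalence_def by auto
  have m: "k \<le> ?m" "k < ?m" by simp_all
  let ?f = "snd \<circ> \<phi> \<circ> collapse_section h s" and ?g = "snd \<circ> \<psi> \<circ> collapse_section h' s'"
  have f: "diagram_preserving n (union_space X A n) (inter_carrier A) (union_space X B n) (inter_carrier B) ?f"
    by (rule diagram_preserving_compose[OF A.diagram_preserving_collapse_section[OF hA dimA m(1)]
          diagram_preserving_compose[OF \<phi> B.diagram_preserving_snd]])
  have g: "diagram_preserving n (union_space X B n) (inter_carrier B) (union_space X A n) (inter_carrier A) ?g"
    by (rule diagram_preserving_compose[OF B.diagram_preserving_collapse_section[OF hB dimB m(1)]
          diagram_preserving_compose[OF \<psi> A.diagram_preserving_snd]])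
  have gf: "diagram_homotopic n (union_space X A n) (inter_carrier A) (union_space X A n) (inter_carrier A) (?g \<circ> ?f) id"
    by (rule composite_through_hocolim_homotopic[OF A B hA hB dimA dimB m(2) \<phi> \<psi> \<psi>\<phi>])
  have fg: "diagram_homotopic n (union_space X B n) (inter_carrier B) (union_space X B n) (inter_carrier B) (?f \<circ> ?g) id"
    by (rule composite_through_hocolim_homotopic[OF B A hB hA dimB dimA m(2) \<psi> \<phi> \<phi>\<psi>])
  show ?thesis
    unfolding family_homotopy_equivalent_def diagram_homotopy_equivalence_def
    using f g gf fg by blast
qed

end
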